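(* Suppose $\sigma_k>\sigma_{k+1}$. For given $P_{XY}$ and $r>0$, there exists a positive constant $\bar\epsilon_0$ that depends only on $P_{XY}$ and $r$, such that for all $\epsilon\in(0,\bar\epsilon_0)$ and $\delta\in(0,1)$, $$\mathbb P_{n,m}\left\{\|\tilde{\mathbf B}\mathbf\Phi_k\|_{\mathrm F}^2-\|\tilde{\mathbf B}\bar{\mathbf\Phi}_k\|_{\mathrm F}^2>\epsilon\right\}<\delta$$ for all $n>\bar N^{(4\bar\alpha_k(r))}(\epsilon,\delta,r)$ (with $m=nr$), where $$\bar N^{(t)}(\epsilon,\delta,r)=\frac{t|\mathcal X|(1+|\mathcal Y|)}{\epsilon}\log\frac{9t(1+r)|\mathcal X||\mathcal Y|}{\epsilon}+\frac t\epsilon\log\frac1\delta .$$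
   Context: Setting. Let $\mathcal X=\{1,\dots,|\mathcal X|\}$ and $\mathcal Y=\{1,\dots,|\mathcal Y|\}$ be finite alphabets and $P_{XY}$ a joint probability distribution on $\mathcal X\times\mathcal Y$ whose marginals satisfy $P_X(x)>0$, $P_Y(y)>0$ for all $x,y$. Let $d=|\mathcal X|$. The matrix $\tilde{\mathbf B}\in\mathbb R^{|\mathcal Y|\times|\mathcal X|}$ has entries $\tilde B(y,x)=\frac{P_{XY}(x,y)-P_X(x)P_Y(y)}{\sqrt{P_X(x)P_Y(y)}}$. Let $\sigma_1\ge\dots\ge\sigma_d\ge0$ be its singular values ($\sigma_i=0$ for $i>|\mathcal Y|$) and $\boldsymbol\phi_1,\dots,\boldsymbol\phi_d\in\mathbb R^d$ corresponding orthonormal right singular vectors (so $\tilde{\mathbf B}^{\mathrm T}\tilde{\mathbf B}\boldsymbol\phi_i=\sigma_i^2\boldsymbol\phi_i$). Fix $k\in\{1,\dots,d-1\}$ and let $\mathbf\Phi_k=[\boldsymbol\phi_1,\dots,\boldsymbol\phi_k]$. $\|\cdot\|_{\mathrm F}$ is the Frobenius norm; logarithms are natural. Semi-supervised estimation. One observes $n$ i.i.d. samples $(x_i,y_i)$ from $P_{XY}$ and, independently, $m=nr$ (an integer) i.i.d. samples from $P_X$; $\mathbb P_{n,m}$ denotes the resulting probability. Let $\hat P_{XY}$ be the empirical joint distribution of the labeled samples (with marginal $\hat P_X$ and conditional $\hat P_{Y|X}$), $Q_X$ the empirical distribution of the unlabeled samples, $\bar P_X=\frac1{1+r}\hat P_X+\frac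 r{1+r}Q_X$, $\bar P_{XY}(x,y)=\hat P_{Y|X}(y|x)\bar P_X(x)$, and $\bar P_Y$ the $\mathcal Y$-marginal of $\bar P_{XY}$. Let $\bar{\mathbf B}\in\mathbb R^{|\mathcal Y|\times|\mathcal X|}$ have entries $\bar B(y,x)=\frac{\bar P_{XY}(x,y)}{\sqrt{\bar P_X(x)\bar P_Y(y)}}-\sqrt{\bar P_X(x)\bar P_Y(y)}$, and let $\bar{\mathbf\Phi}_k\in\mathbb R^{d\times k}$ have as orthonormal columns right singular vectors of $\bar{\mathbf B}$ for its $k$ largest singular values. (An arbitrary fixed convention is used when a denominator vanishes or singular values tie.) Definition of $\bar\alpha_k(r)$. Let $\mathbf L$ be the $(|\mathcal X||\mathcal Y|)\times(|\mathcal X||\mathcal Y|)$ matrix whose entry in row $(x-1)|\mathcal Y|+y$ and column $(x'-1)|\mathcal Y|+y'$ is $$\sqrt{\frac{P_{XY}(x',y')}{P_X(x)P_Y(y)}}\left[\delta_{xx'}\delta_{yy'}-\frac12\left(\frac{\delta_{xx'}}{P_X(x)}+\frac{\delta_{yy'}}{P_Y(y)}\right)\left(P_{XY}(x,y)+P_X(x)P_Y(y)\right)\right].$$ Let $\boldsymbol\theta_{ij}=\boldsymbol\phi_j\otimes(\tilde{\mathbf B}\boldsymbol\phi_i)+\boldsymbol\phi_i\otimes(\tilde{\mathbf B}\boldsymbol\phi_j)$ and $\mathbf G_k=\mathbf L^{\mathrm T}\left(\sum_{i=1}^k\sum_{j=k+1}^d\frac{\boldsymbol\theta_{ij}\boldsymbol\theta_{ij}^{\mathrm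 T}}{\sigma_i^2-\sigma_j^2}\right)\mathbf L$. Let $\bar{\mathbf L}(r)$ be the $(|\mathcal X||\mathcal Y|)\times[|\mathcal X|(|\mathcal Y|+1)]$ matrix whose entry in row $(x-1)|\mathcal Y|+y$ and column $(x'-1)|\mathcal Y|+y'$ is $\delta_{xx'}\delta_{yy'}-\frac r{1+r}\sqrt{P_{Y|X}(y|x)P_{Y|X}(y'|x')}\,\delta_{xx'}$, and whose entry in row $(x-1)|\mathcal Y|+y$ and column $|\mathcal X||\mathcal Y|+x'$ is $\frac{\sqrt r}{1+r}\sqrt{P_{Y|X}(y|x)}\,\delta_{xx'}$. Then $\bar\alpha_k(r)$ is the spectral norm of $\bar{\mathbf G}_k(r)=\bar{\mathbf L}(r)^{\mathrm T}\mathbf G_k\bar{\mathbf L}(r)$. *)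

theory Defs
  imports "HOL-Probability.Probability"
begin

section \<open>Singular systems and the Frobenius norm\<close>

text \<open>
  The singular values of \<open>A\<close> and corresponding orthonormal right singular vectors, both indexed by
  \<open>1, \<dots>, d\<close> where \<open>d\<close> is the number of columns; \<open>\<sigma>\<close> and \<open>\<phi>\<close> are unconstrained outside this range.
  If \<open>d\<close> exceeds the number of rows, the rank of \<open>transpose A ** A\<close> forces the surplus \<open>\<sigma> i\<close> to
  be 0.
\<close>

definition right_singular_system ::
    "real^'a^'b \<Rightarrow> (nat \<Rightarrow> real) \<Rightarrow> (nat \<Rightarrow> real^'a) \<Rightarrow> bool" where
  "right_singular_system A \<sigma> \<phi> \<longleftrightarrow>
     (\<forall>i\<in>{1..CARD('a)}. \<sigma> i \<ge> 0) \<and>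
     (\<forall>i\<in>{1..CARD('a)}. \<forall>j\<in>{1..CARD('a)}. i \<le> j \<longrightarrow> \<sigma> j \<le> \<sigma> i) \<and>
     (\<forall>i\<in>{1..CARD('a)}. \<forall>j\<in>{1..CARD('a)}. \<phi> i \<bullet> \<phi> j = of_bool (i = j)) \<and>
     (\<forall>i\<in>{1..CARD('a)}. (transpose A ** A) *v \<phi> i = (\<sigma> i)\<^sup>2 *\<^sub>R \<phi> i)"

text \<open>
  A matrix with \<open>k\<close> columns, \<open>k\<close> a natural number, is given by its columns \<open>\<Psi> 1, \<dots>, \<Psi> k\<close>.
\<close>

definition orthonormal_columns :: "nat \<Rightarrow> (nat \<Rightarrow> real^'a) \<Rightarrow> bool" where
  "orthonormal_columns k \<Psi> \<longleftrightarrow> (\<forall>i\<in>{1..k}. \<forall>j\<in>{1..k}. \<Psi> i \<bullet> \<Psi> j = of_bool (i = j))"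

definition top_right_singular_vectors :: "real^'a^'b \<Rightarrow> nat \<Rightarrow> (nat \<Rightarrow> real^'a) \<Rightarrow> bool" where
  "top_right_singular_vectors A k \<Psi> \<longleftrightarrow>
     (\<exists>\<sigma> \<phi>. right_singular_system A \<sigma> \<phi> \<and> (\<forall>i\<in>{1..k}. \<Psi> i = \<phi> i))"

text \<open>The Frobenius norm of the product of \<open>A\<close> with the matrix whose columns are \<open>\<Psi> 1, \<dots>, \<Psi> k\<close>.\<close>

definition frobenius_norm_mult :: "real^'a^'b \<Rightarrow> nat \<Rightarrow> (nat \<Rightarrow> real^'a) \<Rightarrow> real" where
  "frobenius_norm_mult A k \<Psi> = sqrt (\<Sum>y\<in>UNIV. \<Sum>i=1..k. ((A *v \<Psi> i) $ y)\<^sup>2)"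


section \<open>Population quantities\<close>

definition PX :: "('x \<times> 'y) pmf \<Rightarrow> 'x \<Rightarrow> real" where
  "PX P x = pmf (map_pmf fst P) x"

definition PY :: "('x \<times> 'y) pmf \<Rightarrow> 'y \<Rightarrow> real" where
  "PY P y = pmf (map_pmf snd P) y"

definition PYX :: "('x \<times> 'y) pmf \<Rightarrow> 'y \<Rightarrow> 'x \<Rightarrow> real" where
  "PYX P y x = pmf P (x, y) / PX P x"

definition B_tilde :: "('x::finite \<times> 'y::finite) pmf \<Rightarrow> real^'x^'y" where
  "B_tilde P = (\<chi> y x. (pmf P (x, y) - PX P x * PY P y) / sqrt (PX P x * PY P y))"

text \<open>
  Rows and columns numbered \<open>(x - 1)|Y| + y\<close> are indexed by the pair \<open>(x, y)\<close>; in \<open>L_bar\<close> such columns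
  are \<open>Inl (x, y)\<close> and the column numbered \<open>|X||Y| + x\<close> is \<open>Inr x\<close>.
\<close>

definition L_mat :: "('x::finite \<times> 'y::finite) pmf \<Rightarrow> real^('x \<times> 'y)^('x \<times> 'y)" where
  "L_mat P = (\<chi> p q. case (p, q) of ((x, y), (x', y')) \<Rightarrow>
     sqrt (pmf P (x', y') / (PX P x * PY P y)) *
     (of_bool (x = x') * of_bool (y = y')
      - 1/2 * (of_bool (x = x') / PX P x + of_bool (y = y') / PY P y)
          * (pmf P (x, y) + PX P x * PY P y)))"

definition kron :: "real^'a \<Rightarrow> real^'b \<Rightarrow> real^('a \<times> 'b)" where
  "kron u v = (\<chi> p. u $ fst p * v $ snd p)"

definition outer :: "real^'a \<Rightarrow> real^'b \<Rightarrow> real^'b^'a" where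
  "outer u v = (\<chi> p q. u $ p * v $ q)"

definition theta ::
    "('x::finite \<times> 'y::finite) pmf \<Rightarrow> (nat \<Rightarrow> real^'x) \<Rightarrow> nat \<Rightarrow> nat \<Rightarrow> real^('x \<times> 'y)" where
  "theta P \<phi> i j = kron (\<phi> j) (B_tilde P *v \<phi> i) + kron (\<phi> i) (B_tilde P *v \<phi> j)"

definition G_mat ::
    "('x::finite \<times> 'y::finite) pmf \<Rightarrow> (nat \<Rightarrow> real) \<Rightarrow> (nat \<Rightarrow> real^'x) \<Rightarrow> nat \<Rightarrow>
     real^('x \<times> 'y)^('x \<times> 'y)" where
  "G_mat P \<sigma> \<phi> k =
     transpose (L_mat P) **
     (\<Sum>i=1..k. \<Sum>j=k+1..CARD('x).
        (1 / ((\<sigma> i)\<^sup>2 - (\<sigma> j)\<^sup>2)) *\<^sub>R outer (theta P \<phi> i j) (theta P \<phi> i j)) **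
     L_mat P"

definition L_bar ::
    "('x::finite \<times> 'y::finite) pmf \<Rightarrow> real \<Rightarrow> real^('x \<times> 'y + 'x)^('x \<times> 'y)" where
  "L_bar P r = (\<chi> p c. case p of (x, y) \<Rightarrow>
     (case c of
        Inl (x', y') \<Rightarrow>
          of_bool (x = x') * of_bool (y = y')
          - r / (1 + r) * sqrt (PYX P y x * PYX P y' x') * of_bool (x = x')
      | Inr x' \<Rightarrow> sqrt r / (1 + r) * sqrt (PYX P y x) * of_bool (x = x')))"

definition alpha_bar ::
    "('x::finite \<times> 'y::finite) pmf \<Rightarrow> (nat \<Rightarrow> real) \<Rightarrow> (nat \<Rightarrow> real^'x) \<Rightarrow> nat \<Rightarrow> real \<Rightarrow> real" where
  "alpha_bar P \<sigma> \<phi> k r =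
     onorm ((*v) (transpose (L_bar P r) ** G_mat P \<sigma> \<phi> k ** L_bar P r))"


section \<open>Semi-supervised estimation\<close>

definition empirical :: "'a list \<Rightarrow> 'a \<Rightarrow> real" where
  "empirical zs a = real (count_list zs a) / real (length zs)"

definition PX_hat :: "('x \<times> 'y::finite) list \<Rightarrow> 'x \<Rightarrow> real" where
  "PX_hat s x = (\<Sum>y\<in>UNIV. empirical s (x, y))"

definition PX_bar :: "real \<Rightarrow> ('x \<times> 'y::finite) list \<Rightarrow> 'x list \<Rightarrow> 'x \<Rightarrow> real" where
  "PX_bar r s u x = 1 / (1 + r) * PX_hat s x + r / (1 + r) * empirical u x"

definition PXY_bar :: "real \<Rightarrow> ('x \<times> 'y::finite) list \<Rightarrow> 'x list \<Rightarrow> 'x \<Rightarrow> 'y \<Rightarrow> real" where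
  "PXY_bar r s u x y = empirical s (x, y) / PX_hat s x * PX_bar r s u x"

definition PY_bar :: "real \<Rightarrow> ('x::finite \<times> 'y::finite) list \<Rightarrow> 'x list \<Rightarrow> 'y \<Rightarrow> real" where
  "PY_bar r s u y = (\<Sum>x\<in>UNIV. PXY_bar r s u x y)"

definition B_bar :: "real \<Rightarrow> ('x::finite \<times> 'y::finite) list \<Rightarrow> 'x list \<Rightarrow> real^'x^'y" where
  "B_bar r s u = (\<chi> y x. PXY_bar r s u x y / sqrt (PX_bar r s u x * PY_bar r s u y)
                          - sqrt (PX_bar r s u x * PY_bar r s u y))"

definition nonvanishing_denominators ::
    "real \<Rightarrow> ('x::finite \<times> 'y::finite) list \<Rightarrow> 'x list \<Rightarrow> bool" where
  "nonvanishing_denominators r s u \<longleftrightarrow>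
     (\<forall>x. PX_hat s x \<noteq> 0) \<and> (\<forall>x. PX_bar r s u x \<noteq> 0) \<and> (\<forall>y. PY_bar r s u y \<noteq> 0)"

text \<open>
  The estimator, as a function of the labeled sample \<open>s\<close> and the unlabeled sample \<open>u\<close>. Any choice
  among tied singular vectors is allowed. If a denominator vanishes, so that \<open>B_bar\<close> depends on a
  convention, any orthonormal columns are allowed; this covers every such convention.
\<close>

definition Phi_bar_estimator ::
    "real \<Rightarrow> nat \<Rightarrow> (('x::finite \<times> 'y::finite) list \<Rightarrow> 'x list \<Rightarrow> nat \<Rightarrow> real^'x) \<Rightarrow> bool" where
  "Phi_bar_estimator r k \<Phi> \<longleftrightarrow>
     (\<forall>s u. orthonormal_columns k (\<Phi> s u) \<and>
        (nonvanishing_denominators r s u \<longrightarrow> top_right_singular_vectors (B_bar r s u) k (\<Phi> s u)))"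

definition sample_law ::
    "('x \<times> 'y) pmf \<Rightarrow> nat \<Rightarrow> nat \<Rightarrow> (('x \<times> 'y) list \<times> 'x list) pmf" where
  "sample_law P n m = pair_pmf (replicate_pmf n P) (replicate_pmf m (map_pmf fst P))"

definition N_bar :: "nat \<Rightarrow> nat \<Rightarrow> real \<Rightarrow> real \<Rightarrow> real \<Rightarrow> real \<Rightarrow> real" where
  "N_bar dX dY t \<epsilon> \<delta> r =
     t * real dX * (1 + real dY) / \<epsilon> * ln (9 * t * (1 + r) * real dX * real dY / \<epsilon>)
     + t / \<epsilon> * ln (1 / \<delta>)"

end

theory Submission
  imports Defs
begin

text \<open>
  Record the errors of the two empirical distributions in a vector \<open>w\<close>, scaled by the square roots of
  the true probabilities. The matrix \<open>B_bar\<close> is a smooth function of \<open>w\<close> near 0 with derivative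
  \<open>L_mat ** L_bar\<close>, and second-order perturbation theory for the spectral projections of
  \<open>transpose B ** B\<close> bounds the loss by a quadratic form whose largest eigenvalue is \<open>alpha_bar\<close>, so by
  \<open>(alpha_bar + o(1)) * (norm w)\<^sup>2\<close>. The relative entropies of the two samples sum up to
  \<open>(1/2 - o(1)) * (norm w)\<^sup>2\<close> per labeled sample. A loss above \<open>\<epsilon>\<close> therefore costs relative entropy at
  least \<open>3 * \<epsilon> / (8 * alpha_bar)\<close>, and the method of types turns this into a probability bound; the
  constant 3/8, instead of the optimal 1/2, absorbs the errors of second order. The factor 4 in
  \<open>4 * alpha_bar\<close> leaves room for the number of types.
\<close>

section \<open>Relative entropy and the method of types\<close>

text \<open>The order of quantifiers shapes the proof: the threshold for \<epsilon> may depend on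
  \<open>P\<close> and \<open>r\<close> only, while \<open>k\<close>, the singular system and the
  estimator with its tie-breaking come after it. So a spectral gap \<open>g\<close> and a positive
  lower bound \<open>a\<close> on \<open>alpha_bar\<close> are made uniform over all admissible
  \<open>k\<close> and singular systems before any radius is fixed. Singular vectors need not depend
  continuously on the matrix when singular values tie inside the top or the bottom block; the loss
  is therefore expressed by the projection onto the span of the top block, which only needs the gap
  between the blocks. The estimator is pinned down only where no denominator vanishes. Samples whose
  deviation is not small, where neither the expansion nor possibly the estimator is under control,
  are dismissed by their relative entropy alone: it is bounded below by a constant, which exceeds
  the required cost once \<epsilon> is small.\<close>

lemma kl_integrand_lower:
  fixes t :: real
  assumes "t \<ge> 0"
  shows "(t - 1)\<^sup>2 / (2 * max 1 t) \<le> t * ln t - t + 1"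
proof -
  consider "t = 0" | "0 < t" "t \<le> 1" | "1 < t" using assms by linarith
  then show ?thesis
  proof cases
    case 2
    have "(1 - 1)\<^sup>2 / 2 - 1 * ln 1 + 1 - 1 \<ge> (t - 1)\<^sup>2 / 2 - t * ln t + t - 1"
    proof (rule DERIV_nonneg_imp_nondecreasing[of t 1 "\<lambda>t. (t - 1)\<^sup>2 / 2 - t * ln t + t - 1"])
      fix x assume x: "t \<le> x" "x \<le> 1"
      then have "x > 0" using 2 by linarith
      then have "((\<lambda>t. (t - 1)\<^sup>2 / 2 - t * ln t + t - 1) has_real_derivative (x - 1 - ln x)) (at x)"
        by (auto intro!: derivative_eq_intros)
      moreover have "x - 1 - ln x \<ge> 0" using ln_le_minus_one[OF \<open>x > 0\<close>] by simp
      ultimately show "\<exists>y. ((\<lambda>t. (t - 1)\<^sup>2 / 2 - t * ln t + t - 1) has_real_derivative y) (at x) \<and> 0 \<le> y"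
        by blast
    qed (use 2 in auto)
    then show ?thesis using 2 by (simp add: max_def)
  next
    case 3
    \<comment> \<open>The rational function agrees with \<open>ln\<close> to second order at 1, as
      it must, because \<open>(t - 1)\<^sup>2 / (2 * t)\<close> is itself exact to second order
      there.\<close>
    have "ln 1 - 2 * (1 - 1) / (1 + 1) \<le> ln t - 2 * (t - 1) / (t + 1)"
    proof (rule DERIV_nonneg_imp_nondecreasing[of 1 t "\<lambda>t. ln t - 2 * (t - 1) / (t + 1)"])
      fix x :: real assume x: "1 \<le> x" "x \<le> t"
      have "((\<lambda>t. ln t - 2 * (t - 1) / (t + 1)) has_real_derivative
          1 / x - (2 * (x + 1) - 2 * (x - 1)) / ((x + 1) * (x + 1))) (at x)"
        using x by (auto intro!: derivative_eq_intros)
      moreover have "1 / x - (2 * (x + 1) - 2 * (x - 1)) / ((x + 1) * (x + 1)) = (x - 1)\<^sup>2 / (x * (x + 1)\<^sup>2)"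
        using x by (simp add: divide_simps) (simp add: algebra_simps power2_eq_square)
      ultimately have "((\<lambda>t. ln t - 2 * (t - 1) / (t + 1)) has_real_derivative (x - 1)\<^sup>2 / (x * (x + 1)\<^sup>2)) (at x)"
        by simp
      then show "\<exists>y. ((\<lambda>t. ln t - 2 * (t - 1) / (t + 1)) has_real_derivative y) (at x) \<and> 0 \<le> y"
        using x by (intro exI[of _ "(x - 1)\<^sup>2 / (x * (x + 1)\<^sup>2)"]) auto
    qed (use 3 in auto)
    then have "t * (2 * (t - 1) / (t + 1)) \<le> t * ln t" using 3 by (intro mult_left_mono) auto
    moreover have "t * (2 * (t - 1) / (t + 1)) - t + 1 = (t - 1)\<^sup>2 / (t + 1)"
      using 3 by (simp add: divide_simps) (simp add: algebra_simps power2_eq_square)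
    moreover have "(t - 1)\<^sup>2 / (2 * t) \<le> (t - 1)\<^sup>2 / (t + 1)"
      using 3 by (intro divide_left_mono) auto
    ultimately show ?thesis using 3 by (simp add: max_def)
  qed simp
qed

text \<open>With \<open>ln 0 = 0\<close> and \<open>a / 0 = 0\<close>, a point where
  \<open>p\<close> vanishes contributes 0 instead of infinity. The sum is used as relative entropy
  only for \<open>q\<close> supported where \<open>p\<close> is positive.\<close>

definition kl :: "('a::finite \<Rightarrow> real) \<Rightarrow> ('a \<Rightarrow> real) \<Rightarrow> real" where
  "kl q p = (\<Sum>z\<in>UNIV. q z * ln (q z / p z))"

text \<open>Both distributions sum to 1, so each summand of \<open>kl\<close> may be completed by
  \<open>- q z + p z\<close>; it is then \<open>p z\<close> times the function of
  \<open>kl_integrand_lower\<close> at the density ratio. The parameter \<open>R\<close> matters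
  because the factor tends to the optimal 2 as the ratio tends to 1.\<close>

lemma kl_lower:
  fixes p q :: "'a::finite \<Rightarrow> real"
  assumes p: "\<And>z. 0 \<le> p z" "(\<Sum>z\<in>UNIV. p z) = 1"
    and q: "\<And>z. 0 \<le> q z" "(\<Sum>z\<in>UNIV. q z) = 1"
    and qp: "\<And>z. q z \<le> R * p z" and R: "R \<ge> 1"
  shows "(\<Sum>z\<in>UNIV. (q z - p z)\<^sup>2 / p z) \<le> 2 * R * kl q p"
proof -
  have "(q z - p z)\<^sup>2 / p z \<le> 2 * R * (q z * ln (q z / p z) - q z + p z)" for z
  proof (cases "p z = 0")
    case True
    then show ?thesis using qp[of z] q(1)[of z] by simp
  next
    case False
    then have pz: "p z > 0" using p(1)[of z] by simp
    define t where "t = q z / p z"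
    have t: "t \<ge> 0" "t \<le> R" and qz: "q z = p z * t"
      using pz q(1)[of z] qp[of z] by (auto simp: t_def field_simps)
    have "(t - 1)\<^sup>2 / (2 * R) \<le> (t - 1)\<^sup>2 / (2 * max 1 t)"
      using t R by (intro divide_left_mono) auto
    also have "\<dots> \<le> t * ln t - t + 1" by (rule kl_integrand_lower[OF t(1)])
    finally have "(t - 1)\<^sup>2 \<le> 2 * R * (t * ln t - t + 1)" using R by (simp add: field_simps)
    then have "p z * (t - 1)\<^sup>2 \<le> p z * (2 * R * (t * ln t - t + 1))"
      using pz by (intro mult_left_mono) auto
    moreover have "(q z - p z)\<^sup>2 / p z = p z * (t - 1)\<^sup>2"
      using pz unfolding qz by (simp add: power2_eq_square field_simps)
    moreover have "p z * (2 * R * (t * ln t - t + 1)) = 2 * R * (q z * ln (q z / p z) - q z + p z)"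
      using pz unfolding qz by (simp add: algebra_simps)
    ultimately show ?thesis by simp
  qed
  then have "(\<Sum>z\<in>UNIV. (q z - p z)\<^sup>2 / p z)
      \<le> (\<Sum>z\<in>UNIV. 2 * R * (q z * ln (q z / p z) - q z + p z))" by (rule sum_mono)
  also have "\<dots> = 2 * R * kl q p"
    by (simp add: sum_distrib_left[symmetric] sum.distrib sum_subtractf p q kl_def)
  finally show ?thesis .
qed

section \<open>Types and their probabilities\<close>

lemma pmf_replicate_pmf:
  "length s = n \<Longrightarrow> pmf (replicate_pmf n p) s = (\<Prod>z\<leftarrow>s. pmf p z)"
proof (induction n arbitrary: s)
  case (Suc n)
  then obtain z s' where s: "s = z # s'" "length s' = n" by (cases s) auto
  have "replicate_pmf (Suc n) p = map_pmf (\<lambda>(x, xs). x # xs) (pair_pmf p (replicate_pmf n p))"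
    by (simp add: pair_pmf_def map_bind_pmf bind_assoc_pmf bind_return_pmf)
  moreover have "pmf \<dots> ((\<lambda>(x, xs). x # xs) (z, s')) = pmf (pair_pmf p (replicate_pmf n p)) (z, s')"
    by (intro pmf_map_inj') (auto simp: inj_def)
  ultimately show ?case using Suc.IH[OF s(2)] by (simp add: s pmf_pair)
qed simp

lemma sum_list_eq_sum_count:
  "(\<Sum>z\<leftarrow>s. h z) = (\<Sum>z\<in>UNIV. real (count_list s z) * (h z :: real))" for s :: "'a::finite list"
proof (induction s)
  case (Cons x s)
  have "(\<Sum>z\<in>UNIV. real (count_list (x # s) z) * h z)
      = (\<Sum>z\<in>UNIV. real (count_list s z) * h z + (if x = z then h z else 0))"
    by (intro sum.cong) (auto simp: distrib_right)
  then show ?case using Cons by (simp add: sum.distrib)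
qed simp

lemma sum_empirical: "s \<noteq> [] \<Longrightarrow> (\<Sum>z\<in>UNIV. empirical s z) = 1" for s :: "'a::finite list"
  using sum_list_eq_sum_count[of "\<lambda>_. 1" s, symmetric]
  by (simp add: empirical_def sum_divide_distrib[symmetric] sum_list_triv)

lemma empirical_nonneg: "empirical s z \<ge> 0"
  by (simp add: empirical_def)

text \<open>
  The samples of the type of \<open>s\<^sub>0\<close> have mass at most 1 under the product law of the empirical
  distribution of \<open>s\<^sub>0\<close>, and the density ratio of the two product laws is constant on the type.
\<close>

lemma prob_type_class:
  fixes P :: "'a::finite pmf"
  assumes s0: "length s0 = n" "set s0 \<subseteq> set_pmf P" and n: "n > 0"
  shows "measure_pmf.prob (replicate_pmf n P) {s. mset s = mset s0}
    \<le> exp (- real n * kl (empirical s0) (pmf P))"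
proof -
  let ?T = "{s. mset s = mset s0}"
  define Q where "Q = pmf_of_multiset (mset s0)"
  have ne: "mset s0 \<noteq> {#}" using s0 n by auto
  have Q: "pmf Q z = empirical s0 z" for z
    using ne by (simp add: Q_def empirical_def count_mset)
  have len: "length s = n" if "s \<in> ?T" for s using that s0 by (auto dest: mset_eq_length)
  have fin: "finite ?T" by (rule mset_eq_finite)
  have eq: "pmf (replicate_pmf n P) s = exp (- real n * kl (empirical s0) (pmf P)) * pmf (replicate_pmf n Q) s"
    if s: "s \<in> ?T" for s
  proof -
    have mem: "z \<in> set s0" if "z \<in> set s" for z using s that by (auto dest: mset_eq_setD)
    have "(\<Prod>z\<leftarrow>s. pmf P z) = (\<Prod>z\<leftarrow>s. exp (- ln (pmf Q z / pmf P z)) * pmf Q z)"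
    proof (intro arg_cong[of _ _ prod_list] map_cong refl)
      fix z assume "z \<in> set s"
      then have "pmf P z > 0" "pmf Q z > 0"
        using mem[of z] s0(2) ne by (auto simp: Q_def pmf_positive)
      then show "pmf P z = exp (- ln (pmf Q z / pmf P z)) * pmf Q z"
        by (simp add: exp_minus)
    qed
    also have "\<dots> = exp (- (\<Sum>z\<leftarrow>s. ln (pmf Q z / pmf P z))) * (\<Prod>z\<leftarrow>s. pmf Q z)"
      by (induction s) (auto simp: exp_add exp_diff exp_minus field_simps)
    also have "(\<Sum>z\<leftarrow>s. ln (pmf Q z / pmf P z)) = (\<Sum>z\<leftarrow>s0. ln (pmf Q z / pmf P z))"
      using s by (simp flip: sum_mset_sum_list)
    also have "\<dots> = real n * kl (empirical s0) (pmf P)"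
      using n s0(1) unfolding sum_list_eq_sum_count kl_def Q
      by (simp add: sum_distrib_left empirical_def)
    finally show ?thesis using len[OF s] by (simp add: pmf_replicate_pmf)
  qed
  have "measure_pmf.prob (replicate_pmf n P) ?T = (\<Sum>s\<in>?T. pmf (replicate_pmf n P) s)"
    by (rule measure_measure_pmf_finite[OF fin])
  also have "\<dots> = exp (- real n * kl (empirical s0) (pmf P)) * (\<Sum>s\<in>?T. pmf (replicate_pmf n Q) s)"
    unfolding sum_distrib_left by (intro sum.cong refl eq)
  also have "(\<Sum>s\<in>?T. pmf (replicate_pmf n Q) s) \<le> 1"
    using measure_measure_pmf_finite[OF fin, of "replicate_pmf n Q"]
    by (metis measure_pmf.prob_le_1)
  finally show ?thesis by simp
qed

lemma card_multisets_le:
  "finite {M :: 'a::finite multiset. size M = n}"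
  "card {M :: 'a::finite multiset. size M = n} \<le> (n + 1) ^ CARD('a)"
proof -
  let ?F = "UNIV \<rightarrow>\<^sub>E {..n} :: ('a \<Rightarrow> nat) set"
  have sub: "count ` {M :: 'a multiset. size M = n} \<subseteq> ?F"
    by (auto simp: PiE_iff intro: count_le_size order_trans)
  have inj: "inj_on count {M :: 'a multiset. size M = n}" by (auto simp: inj_on_def multiset_eq_iff)
  have fin: "finite ?F" by (intro finite_PiE) auto
  show "finite {M :: 'a::finite multiset. size M = n}"
    using finite_imageD[OF finite_subset[OF sub fin] inj] .
  have "card {M :: 'a multiset. size M = n} = card (count ` {M :: 'a multiset. size M = n})"
    by (simp add: card_image inj)
  also have "\<dots> \<le> card ?F" by (intro card_mono fin sub)
  finally show "card {M :: 'a::finite multiset. size M = n} \<le> (n + 1) ^ CARD('a)"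
    by (simp add: card_funcsetE)
qed

text \<open>The event \<open>A\<close> need not be a union of type classes, since the estimator may
  depend on the order of the samples. Each point of \<open>A\<close> in the support is covered by
  the whole product of type classes containing it; the bound \<open>D\<close> extends to that
  product because relative entropies depend on the type only. A union bound then counts pairs of
  types.\<close>

lemma method_of_types:
  fixes P :: "'a::finite pmf" and Q :: "'b::finite pmf"
  assumes n: "n > 0" and m: "m > 0"
    and D: "\<And>s u. (s, u) \<in> A \<Longrightarrow> length s = n \<Longrightarrow> set s \<subseteq> set_pmf P \<Longrightarrow> length u = m \<Longrightarrow>
      set u \<subseteq> set_pmf Q \<Longrightarrow> D \<le> real n * kl (empirical s) (pmf P) + real m * kl (empirical u) (pmf Q)"
  shows "measure_pmf.prob (pair_pmf (replicate_pmf n P) (replicate_pmf m Q)) A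
    \<le> real (n + 1) ^ CARD('a) * real (m + 1) ^ CARD('b) * exp (- D)"
proof -
  let ?M = "pair_pmf (replicate_pmf n P) (replicate_pmf m Q)"
  define A' where "A' = A \<inter> set_pmf ?M"
  define T where "T = (\<lambda>(s, u). (mset s, mset u)) ` A'"
  let ?N = "{M :: 'a multiset. size M = n} \<times> {M :: 'b multiset. size M = m}"
  define C where "C = (\<lambda>(M, N). {s. mset s = (M :: 'a multiset)} \<times> {u. mset u = (N :: 'b multiset)})"
  have A': "(s, u) \<in> A \<and> length s = n \<and> set s \<subseteq> set_pmf P \<and> length u = m \<and> set u \<subseteq> set_pmf Q"
    if "(s, u) \<in> A'" for s u
    using that by (auto simp: A'_def set_replicate_pmf)
  have TN: "T \<subseteq> ?N" using A' by (auto simp: T_def)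
  have finN: "finite ?N" by (intro finite_cartesian_product card_multisets_le)
  then have finT: "finite T" using TN finite_subset by blast
  have "measure_pmf.prob ?M A = measure_pmf.prob ?M A'"
    unfolding A'_def by (simp add: measure_Int_set_pmf del: set_pair_pmf)
  also have "\<dots> \<le> measure_pmf.prob ?M (\<Union>\<tau>\<in>T. C \<tau>)"
    by (intro measure_pmf.finite_measure_mono) (auto simp: T_def C_def)
  also have "\<dots> \<le> (\<Sum>\<tau>\<in>T. measure_pmf.prob ?M (C \<tau>))"
    by (intro measure_pmf.finite_measure_subadditive_finite finT) auto
  also have "\<dots> \<le> (\<Sum>\<tau>\<in>T. exp (- D))"
  proof (rule sum_mono)
    fix \<tau> assume "\<tau> \<in> T"
    then obtain s u where su: "(s, u) \<in> A'" "\<tau> = (mset s, mset u)" by (auto simp: T_def)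
    have "measure_pmf.prob ?M (C \<tau>) = measure_pmf.prob (replicate_pmf n P) {s'. mset s' = mset s}
        * measure_pmf.prob (replicate_pmf m Q) {u'. mset u' = mset u}"
      unfolding C_def su(2) prod.case
      by (intro measure_pmf_prob_product countable_finite mset_eq_finite)
    also have "\<dots> \<le> exp (- real n * kl (empirical s) (pmf P)) * exp (- real m * kl (empirical u) (pmf Q))"
      using A'[OF su(1)] n m by (intro mult_mono prob_type_class) auto
    also have "\<dots> \<le> exp (- D)"
      using A'[OF su(1)] D[of s u] by (simp flip: exp_add)
    finally show "measure_pmf.prob ?M (C \<tau>) \<le> exp (- D)" .
  qed
  also have "\<dots> = real (card T) * exp (- D)" by simp
  also have "card T \<le> card ?N" by (intro card_mono finN TN)
  also have "card ?N \<le> (n + 1) ^ CARD('a) * (m + 1) ^ CARD('b)"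
    unfolding card_cartesian_product by (intro mult_mono card_multisets_le) auto
  finally show ?thesis by (simp add: mult_right_mono)
qed

text \<open>With \<open>u = n * \<epsilon> / t\<close> the exponent is \<open>3 / 2 * u\<close>. The
  requirement on \<open>n\<close> says \<open>c * ln M - ln \<delta> < u\<close>, and the remaining
  \<open>u / 2\<close> pays for replacing \<open>ln x\<close>, which grows with \<open>n\<close>, by
  the fixed \<open>ln M\<close>, through \<open>ln (x / M) \<le> x / M - 1\<close>.\<close>

lemma sample_size_bound:
  fixes a b n :: nat and t r \<epsilon> \<delta> :: real
  assumes ab: "a \<ge> 1" "b \<ge> 1" and n: "n \<ge> 1" and t: "t > 0" and r: "r > 0" and \<epsilon>: "\<epsilon> > 0" and \<delta>: "\<delta> > 0"
    and m: "real m = real n * r" and N: "real n > N_bar a b t \<epsilon> \<delta> r"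
  shows "real (n + 1) ^ (a * b) * real (m + 1) ^ a * exp (- (real n * (3 * \<epsilon> / (2 * t)))) < \<delta>"
proof -
  define c where "c = real (a * b + a)"
  define x where "x = real n * (1 + r) + 1"
  define M where "M = 9 * t * (1 + r) * real a * real b / \<epsilon>"
  define u where "u = real n * \<epsilon> / t"
  have pos: "c > 0" "x > 0" "M > 0" "u > 0" "real a * real b > 0"
    using ab n t r \<epsilon> by (auto simp: c_def x_def M_def u_def add_pos_nonneg add_nonneg_pos)
  have "real a * 1 \<le> real a * real b" using ab by (intro mult_left_mono) auto
  then have c_le: "c \<le> 2 * (real a * real b)" by (simp add: c_def)
  have "1 * 1 \<le> real n * (1 + r)" using n r by (intro mult_mono) auto
  then have "x / M \<le> 2 * (real n * (1 + r)) / M"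
    using pos by (intro divide_right_mono) (auto simp: x_def)
  also have "\<dots> = 2 * u / (9 * (real a * real b))"
    using t r \<epsilon> ab by (simp add: M_def u_def divide_simps)
  \<comment> \<open>Here the constant 9 of \<open>N_bar\<close> enters: 2 / 9 is at most 1 /
    4.\<close>
  also have "\<dots> \<le> u / (4 * (real a * real b))" using pos by (simp add: divide_simps)
  also have "\<dots> \<le> u / (2 * c)" using pos c_le by (intro divide_left_mono) auto
  finally have "ln (x / M) \<le> u / (2 * c)" using ln_le_minus_one[of "x / M"] pos by simp
  then have 1: "c * ln x \<le> u / 2 + c * ln M"
    using pos by (simp add: ln_div field_simps)
  have "N_bar a b t \<epsilon> \<delta> r = t / \<epsilon> * (c * ln M - ln \<delta>)"
    using \<delta> by (simp add: N_bar_def c_def M_def ln_div algebra_simps add_divide_distrib diff_divide_distrib)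
  then have "(c * ln M - ln \<delta>) * (t / \<epsilon>) < real n" using N by (simp add: mult.commute)
  then have "c * ln M - ln \<delta> < real n / (t / \<epsilon>)" using t \<epsilon> by (subst pos_less_divide_eq) auto
  then have 2: "c * ln M - ln \<delta> < u" by (simp add: u_def)
  have "real (n + 1) ^ (a * b) * real (m + 1) ^ a \<le> x ^ (a * b) * x ^ a"
    using r m by (intro mult_mono power_mono) (auto simp: x_def algebra_simps)
  also have "\<dots> = exp (c * ln x)"
    using pos by (simp add: c_def exp_of_nat_mult flip: power_add of_nat_add of_nat_mult)
  finally have "real (n + 1) ^ (a * b) * real (m + 1) ^ a * exp (- (real n * (3 * \<epsilon> / (2 * t))))
      \<le> exp (c * ln x) * exp (- (real n * (3 * \<epsilon> / (2 * t))))"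
    by (intro mult_right_mono) auto
  also have "\<dots> = exp (c * ln x - 3 / 2 * u)"
    using t by (simp add: u_def flip: exp_add)
  also have "\<dots> < exp (ln \<delta>)" using 1 2 by simp
  finally show ?thesis using \<delta> by simp
qed

section \<open>Perturbation of spectral projections\<close>

text \<open>\<open>c\<close> is an orthogonal matrix whose index set is split into the top block
  \<open>K\<close> and the rest \<open>J\<close>. Rows and columns are both assumed orthonormal so
  that the transpose is an instance too, which exchanges the roles of the two eigenbases.\<close>

locale orthogonal_coefficients =
  fixes c :: "'i \<Rightarrow> 'i \<Rightarrow> real" and K J :: "'i set"
  assumes finite: "finite K" "finite J" and disjoint: "K \<inter> J = {}"
    and rows: "\<And>u v. u \<in> K \<union> J \<Longrightarrow> v \<in> K \<union> J \<Longrightarrow> (\<Sum>l\<in>K \<union> J. c u l * c v l) = of_bool (u = v)"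
    and cols: "\<And>l m. l \<in> K \<union> J \<Longrightarrow> m \<in> K \<union> J \<Longrightarrow> (\<Sum>u\<in>K \<union> J. c u l * c u m) = of_bool (l = m)"
begin

text \<open>
  For \<open>c u l = \<phi> u \<bullet> \<psi> l\<close> with orthonormal bases \<open>\<phi>\<close> and \<open>\<psi>\<close>, \<open>p\<close> and \<open>q\<close> are the matrices, in the
  basis \<open>\<phi>\<close>, of the complementary projections onto the spans of \<open>\<psi> ` K\<close> and \<open>\<psi> ` J\<close>, and \<open>S\<close> is the
  sum of the squared sines of the angles between the spans of \<open>\<phi> ` K\<close> and \<open>\<psi> ` K\<close>.
\<close>

definition p where "p u v = (\<Sum>l\<in>K. c u l * c v l)"
definition q where "q u v = (\<Sum>l\<in>J. c u l * c v l)"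
definition S where "S = (\<Sum>j\<in>J. p j j)"

lemma p_commute: "p u v = p v u" and q_commute: "q u v = q v u"
  by (simp_all add: p_def q_def mult.commute)

lemma p_diag_nonneg: "p u u \<ge> 0" and q_diag_nonneg: "q u u \<ge> 0"
  by (auto simp: p_def q_def intro!: sum_nonneg)

lemma p_plus_q: "p u v + q u v = of_bool (u = v)" if "u \<in> K \<union> J" "v \<in> K \<union> J"
  using rows[OF that] finite disjoint by (simp add: p_def q_def sum.union_disjoint)

lemma sum_split: "(\<Sum>u\<in>K \<union> J. f u) = (\<Sum>u\<in>K. f u) + (\<Sum>u\<in>J. (f u :: real))"
  using finite disjoint by (simp add: sum.union_disjoint)

lemma sum_of_bool_left: "(\<Sum>u\<in>K \<union> J. of_bool (u = v) * f u) = (f v :: real)" if "v \<in> K \<union> J"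
proof -
  have "(\<Sum>u\<in>K \<union> J. of_bool (u = v) * f u) = (\<Sum>u\<in>K \<union> J. if u = v then f u else 0)"
    by (intro sum.cong) auto
  then show ?thesis using that finite by simp
qed

lemma block_idempotent:
  assumes "L \<subseteq> K \<union> J"
  shows "(\<Sum>v\<in>K \<union> J. (\<Sum>l\<in>L. c u l * c v l)\<^sup>2) = (\<Sum>l\<in>L. c u l * c u l)"
proof -
  have fL: "finite L" using assms finite finite_subset by blast
  have "(\<Sum>v\<in>K \<union> J. (\<Sum>l\<in>L. c u l * c v l)\<^sup>2)
      = (\<Sum>v\<in>K \<union> J. \<Sum>l\<in>L. \<Sum>m\<in>L. c u l * c u m * (c v l * c v m))"
    by (simp add: power2_eq_square sum_product mult_ac)
  also have "\<dots> = (\<Sum>l\<in>L. \<Sum>m\<in>L. \<Sum>v\<in>K \<union> J. c u l * c u m * (c v l * c v m))"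
    by (subst sum.swap, rule sum.cong[OF refl], rule sum.swap)
  also have "\<dots> = (\<Sum>l\<in>L. \<Sum>m\<in>L. c u l * c u m * of_bool (l = m))"
    by (intro sum.cong refl)
      (simp add: cols[OF subsetD[OF assms] subsetD[OF assms]] flip: sum_distrib_left)
  also have "\<dots> = (\<Sum>l\<in>L. c u l * c u l)"
  proof (intro sum.cong refl)
    fix l assume "l \<in> L"
    have "(\<Sum>m\<in>L. c u l * c u m * of_bool (l = m)) = (\<Sum>m\<in>L. if l = m then c u l * c u m else 0)"
      by (intro sum.cong) auto
    then show "(\<Sum>m\<in>L. c u l * c u m * of_bool (l = m)) = c u l * c u l"
      using \<open>l \<in> L\<close> fL by simp
  qed
  finally show ?thesis .
qed

lemma p_idempotent: "(\<Sum>v\<in>K \<union> J. (p u v)\<^sup>2) = p u u"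
  and q_idempotent: "(\<Sum>v\<in>K \<union> J. (q u v)\<^sup>2) = q u u"
  unfolding p_def q_def by (intro block_idempotent; blast)+

text \<open>The projection \<open>p\<close> has trace \<open>card K\<close>, so the part of its
  trace that falls on \<open>J\<close> equals the part missing on \<open>K\<close>.\<close>

lemma S_eq_sum_q: "S = (\<Sum>i\<in>K. q i i)"
proof -
  have "(\<Sum>u\<in>K \<union> J. p u u) = (\<Sum>l\<in>K. \<Sum>u\<in>K \<union> J. c u l * c u l)"
    unfolding p_def by (rule sum.swap)
  also have "\<dots> = (\<Sum>l\<in>K. 1)" by (intro sum.cong refl) (simp add: cols)
  finally have "(\<Sum>i\<in>K. p i i) + S = (\<Sum>i\<in>K. 1)" by (simp only: sum_split S_def)
  moreover have "(\<Sum>i\<in>K. p i i) + (\<Sum>i\<in>K. q i i) = (\<Sum>i\<in>K. 1)"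
    by (subst sum.distrib[symmetric], intro sum.cong refl) (simp add: p_plus_q)
  ultimately show ?thesis by linarith
qed

lemma S_nonneg: "S \<ge> 0"
  unfolding S_def by (intro sum_nonneg p_diag_nonneg)

lemma quadratic_forms:
  "(\<Sum>l\<in>K. \<Sum>u\<in>K \<union> J. s u * (c u l)\<^sup>2) = (\<Sum>u\<in>K \<union> J. s u * p u u)"
  by (subst sum.swap) (simp add: p_def sum_distrib_left power2_eq_square)

lemma gap_eq:
  "(\<Sum>i\<in>K. s i) - (\<Sum>l\<in>K. \<Sum>u\<in>K \<union> J. s u * (c u l)\<^sup>2) = (\<Sum>i\<in>K. s i * q i i) - (\<Sum>j\<in>J. s j * p j j)"
proof -
  have "(\<Sum>i\<in>K. s i) = (\<Sum>i\<in>K. s i * p i i) + (\<Sum>i\<in>K. s i * q i i)"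
    by (subst sum.distrib[symmetric], intro sum.cong refl) (simp add: p_plus_q flip: distrib_left)
  then show ?thesis unfolding quadratic_forms by (simp add: sum_split)
qed

text \<open>By \<open>gap_eq\<close> the loss arises from moving weight \<open>S\<close> from values
  at least \<open>m\<close> to values at most \<open>m - g\<close>. With \<open>g = 0\<close> and
  the bases exchanged, this is the optimality of the perturbed eigenspace.\<close>

lemma gap_lower:
  assumes "\<And>i. i \<in> K \<Longrightarrow> m \<le> s i" and "\<And>j. j \<in> J \<Longrightarrow> s j \<le> m - g"
  shows "g * S \<le> (\<Sum>i\<in>K. s i) - (\<Sum>l\<in>K. \<Sum>u\<in>K \<union> J. s u * (c u l)\<^sup>2)"
proof -
  have "m * S \<le> (\<Sum>i\<in>K. s i * q i i)"
    unfolding S_eq_sum_q sum_distrib_left by (intro sum_mono mult_right_mono assms q_diag_nonneg)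
  moreover have "(\<Sum>j\<in>J. s j * p j j) \<le> (m - g) * S"
    unfolding S_def sum_distrib_left by (intro sum_mono mult_right_mono assms p_diag_nonneg)
  ultimately show ?thesis unfolding gap_eq by (simp add: algebra_simps)
qed

text \<open>Idempotence splits \<open>q i i\<close> into squares over \<open>J\<close>, which equal
  \<open>(p i j)\<^sup>2\<close> and give the main term, and squares over \<open>K\<close>, which
  are at most \<open>q i i * q i' i'\<close> and sum up to at most \<open>S\<^sup>2\<close>. As
  \<open>S\<close> turns out to be of second order, the latter are of fourth order. In the terms
  \<open>p j j\<close> the squares inside \<open>J\<close> are dropped.\<close>

lemma gap_upper:
  assumes "\<And>i. i \<in> K \<Longrightarrow> s i \<le> b" and "\<And>j. j \<in> J \<Longrightarrow> 0 \<le> s j" and b: "0 \<le> b"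
  shows "(\<Sum>i\<in>K. s i) - (\<Sum>l\<in>K. \<Sum>u\<in>K \<union> J. s u * (c u l)\<^sup>2)
    \<le> (\<Sum>i\<in>K. \<Sum>j\<in>J. (s i - s j) * (p i j)\<^sup>2) + b * S\<^sup>2"
proof -
  have pq: "(q i j)\<^sup>2 = (p i j)\<^sup>2" if "i \<in> K" "j \<in> J" for i j
  proof -
    have "p i j + q i j = 0" using that disjoint p_plus_q[of i j] by auto
    then show ?thesis by (metis add_eq_0_iff power2_minus)
  qed
  have "(\<Sum>i\<in>K. s i * q i i) = (\<Sum>i\<in>K. s i * ((\<Sum>i'\<in>K. (q i i')\<^sup>2) + (\<Sum>j\<in>J. (p i j)\<^sup>2)))"
    by (intro sum.cong refl, subst q_idempotent[symmetric]) (simp add: sum_split pq)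
  also have "\<dots> = (\<Sum>i\<in>K. s i * (\<Sum>i'\<in>K. (q i i')\<^sup>2)) + (\<Sum>i\<in>K. \<Sum>j\<in>J. s i * (p i j)\<^sup>2)"
    by (simp add: distrib_left sum.distrib sum_distrib_left)
  finally have 1: "(\<Sum>i\<in>K. s i * q i i) = \<dots>" .
  have "(\<Sum>i\<in>K. \<Sum>j\<in>J. s j * (p i j)\<^sup>2) = (\<Sum>j\<in>J. s j * (\<Sum>i\<in>K. (p j i)\<^sup>2))"
    by (subst sum.swap) (simp add: sum_distrib_left p_commute)
  also have "\<dots> \<le> (\<Sum>j\<in>J. s j * p j j)"
    by (intro sum_mono mult_left_mono assms, subst p_idempotent[symmetric])
      (auto simp: sum_split intro!: sum_nonneg)
  finally have 2: "(\<Sum>i\<in>K. \<Sum>j\<in>J. s j * (p i j)\<^sup>2) \<le> \<dots>" .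
  have "(\<Sum>i\<in>K. s i * (\<Sum>i'\<in>K. (q i i')\<^sup>2)) \<le> (\<Sum>i\<in>K. b * (\<Sum>i'\<in>K. (q i i')\<^sup>2))"
    by (intro sum_mono mult_right_mono assms sum_nonneg) auto
  also have "\<dots> = b * (\<Sum>i\<in>K. \<Sum>i'\<in>K. (q i i')\<^sup>2)"
    by (simp only: sum_distrib_left)
  also have "\<dots> \<le> b * (\<Sum>i\<in>K. \<Sum>i'\<in>K. q i i * q i' i')"
  proof (rule mult_left_mono[OF _ b], intro sum_mono)
    fix i i' assume "i \<in> K" "i' \<in> K"
    show "(q i i')\<^sup>2 \<le> q i i * q i' i'"
      using Cauchy_Schwarz_ineq_sum[of "c i" "c i'" J] by (simp add: q_def power2_eq_square)
  qed
  also have "\<dots> = b * S\<^sup>2" by (simp add: S_eq_sum_q power2_eq_square sum_product)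
  finally have 3: "(\<Sum>i\<in>K. s i * (\<Sum>i'\<in>K. (q i i')\<^sup>2)) \<le> b * S\<^sup>2" .
  show ?thesis unfolding gap_eq 1 using 2 3
    by (simp add: left_diff_distrib sum_subtractf)
qed

text \<open>
  \<open>E\<close> is the difference of two symmetric matrices with eigenvalues \<open>t\<close> and \<open>s\<close>. By optimality of both
  eigenspaces the gap is at most the trace of \<open>E * (p - projection onto K)\<close>, which forces \<open>S\<close> to be
  of second order. Since \<open>p\<close> commutes with the perturbed matrix, \<open>(s i - s j) * p i j\<close> is the
  \<open>(i, j)\<close> entry of a commutator of \<open>E\<close> with \<open>p\<close>, hence \<open>E i j\<close> up to second order.
\<close>

lemma perturbation_bound:
  fixes E :: "'i \<Rightarrow> 'i \<Rightarrow> real"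
  assumes g: "g > 0" and b: "b \<ge> 0"
    and s: "\<And>i. i \<in> K \<Longrightarrow> m \<le> s i" "\<And>j. j \<in> J \<Longrightarrow> s j \<le> m - g"
    and s_bounds: "\<And>i. i \<in> K \<Longrightarrow> s i \<le> b" "\<And>j. j \<in> J \<Longrightarrow> 0 \<le> s j"
    and t: "\<And>i. i \<in> K \<Longrightarrow> m' \<le> t i" "\<And>j. j \<in> J \<Longrightarrow> t j \<le> m'"
    and E: "\<And>u v. u \<in> K \<union> J \<Longrightarrow> v \<in> K \<union> J \<Longrightarrow>
      E u v = (\<Sum>l\<in>K \<union> J. t l * (c u l * c v l)) - s u * of_bool (u = v)"
    and N: "(\<Sum>u\<in>K \<union> J. \<Sum>v\<in>K \<union> J. (E u v)\<^sup>2) \<le> \<nu>\<^sup>2" and \<nu>: "0 \<le> \<nu>"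
  shows "(\<Sum>i\<in>K. s i) - (\<Sum>l\<in>K. \<Sum>u\<in>K \<union> J. s u * (c u l)\<^sup>2)
    \<le> (\<Sum>i\<in>K. \<Sum>j\<in>J. (E i j)\<^sup>2 / (s i - s j))
       + (real (card K * card J) * (6 * \<nu> ^ 3 / g\<^sup>2 + 9 * \<nu> ^ 4 / g ^ 3) + 4 * b * \<nu> ^ 4 / g ^ 4)"
proof -
  define gap where "gap = (\<Sum>i\<in>K. s i) - (\<Sum>l\<in>K. \<Sum>u\<in>K \<union> J. s u * (c u l)\<^sup>2)"
  let ?I = "K \<union> J"
  have fI: "finite ?I" using finite by simp
  have lower: "g * S \<le> gap" unfolding gap_def using gap_lower[of m s g] s by auto
  interpret T: orthogonal_coefficients "\<lambda>u v. c v u" K J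
    using finite disjoint rows cols by unfold_locales auto
  have optimal: "0 \<le> (\<Sum>i\<in>K. t i) - (\<Sum>l\<in>K. \<Sum>u\<in>?I. t u * (c l u)\<^sup>2)"
    using T.gap_lower[of m' t 0] t by auto
  have row_sum: "(\<Sum>v\<in>?I. of_bool (u = v) * h v) = (h u :: real)" if "u \<in> ?I" for u h
    using sum_of_bool_left[OF that, of h] by (simp add: eq_commute)
  define Ab where "Ab u v = (\<Sum>l\<in>?I. t l * (c u l * c v l))" for u v
  \<comment> \<open>The right side is symmetric in \<open>u\<close> and \<open>w\<close>: the
    perturbed matrix commutes with its spectral projection.\<close>
  have Ab_p: "(\<Sum>v\<in>?I. Ab u v * p v w) = (\<Sum>l\<in>K. t l * (c u l * c w l))" for u w
  proof -
    have "(\<Sum>v\<in>?I. Ab u v * p v w) = (\<Sum>v\<in>?I. \<Sum>l\<in>?I. \<Sum>m\<in>K. t l * c u l * c w m * (c v l * c v m))"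
      unfolding Ab_def p_def sum_product by (simp add: mult_ac)
    also have "\<dots> = (\<Sum>l\<in>?I. \<Sum>m\<in>K. \<Sum>v\<in>?I. t l * c u l * c w m * (c v l * c v m))"
      by (subst sum.swap, rule sum.cong[OF refl], rule sum.swap)
    also have "\<dots> = (\<Sum>l\<in>?I. \<Sum>m\<in>K. t l * c u l * c w m * of_bool (l = m))"
      by (intro sum.cong refl) (simp add: cols flip: sum_distrib_left)
    also have "\<dots> = (\<Sum>m\<in>K. \<Sum>l\<in>?I. of_bool (l = m) * (t l * c u l * c w m))"
      by (subst sum.swap) (simp add: mult_ac)
    also have "\<dots> = (\<Sum>m\<in>K. t m * c u m * c w m)"
      by (intro sum.cong refl sum_of_bool_left) auto
    finally show ?thesis by (simp add: mult_ac)
  qed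
  have "(\<Sum>u\<in>?I. \<Sum>v\<in>?I. E u v * p u v) = (\<Sum>l\<in>K. t l) - (\<Sum>u\<in>?I. s u * p u u)"
  proof -
    have "(\<Sum>u\<in>?I. \<Sum>v\<in>?I. E u v * p u v)
        = (\<Sum>u\<in>?I. \<Sum>v\<in>?I. Ab u v * p v u)
          - (\<Sum>u\<in>?I. \<Sum>v\<in>?I. of_bool (u = v) * (s u * p u v))"
      unfolding sum_subtractf[symmetric]
      by (intro sum.cong refl)
        (simp add: E Ab_def p_commute left_diff_distrib right_diff_distrib mult_ac)
    also have "(\<Sum>u\<in>?I. \<Sum>v\<in>?I. of_bool (u = v) * (s u * p u v)) = (\<Sum>u\<in>?I. s u * p u u)"
      by (intro sum.cong refl row_sum)
    also have "(\<Sum>u\<in>?I. \<Sum>v\<in>?I. Ab u v * p v u) = (\<Sum>l\<in>K. t l * (\<Sum>u\<in>?I. c u l * c u l))"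
      unfolding Ab_p sum_distrib_left by (rule sum.swap)
    also have "\<dots> = (\<Sum>l\<in>K. t l)"
      by (intro sum.cong refl) (simp add: cols)
    finally show ?thesis .
  qed
  moreover have "(\<Sum>i\<in>K. E i i) = (\<Sum>l\<in>K. \<Sum>u\<in>?I. t u * (c l u)\<^sup>2) - (\<Sum>i\<in>K. s i)"
    by (simp add: E sum_subtractf power2_eq_square)
  ultimately have "gap \<le> (\<Sum>u\<in>?I. \<Sum>v\<in>?I. E u v * p u v) - (\<Sum>i\<in>K. E i i)"
    using optimal unfolding gap_def quadratic_forms by linarith
  also have "(\<Sum>i\<in>K. E i i) = (\<Sum>u\<in>?I. \<Sum>v\<in>?I. E u v * (of_bool (u = v) * of_bool (u \<in> K)))"
  proof -
    have "(\<Sum>u\<in>?I. \<Sum>v\<in>?I. E u v * (of_bool (u = v) * of_bool (u \<in> K)))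
        = (\<Sum>u\<in>?I. \<Sum>v\<in>?I. of_bool (u = v) * (E u v * of_bool (u \<in> K)))"
      by (simp add: mult_ac)
    also have "\<dots> = (\<Sum>u\<in>?I. E u u * of_bool (u \<in> K))" by (intro sum.cong refl row_sum)
    also have "\<dots> = (\<Sum>i\<in>K. E i i)" using disjoint
      by (subst sum_split) (auto intro!: sum.neutral)
    finally show ?thesis ..
  qed
  also have "(\<Sum>u\<in>?I. \<Sum>v\<in>?I. E u v * p u v) - \<dots>
      = (\<Sum>(u, v)\<in>?I \<times> ?I. E u v * (p u v - of_bool (u = v) * of_bool (u \<in> K)))"
    by (simp add: sum.cartesian_product[symmetric] right_diff_distrib sum_subtractf)
  finally have gap_le: "gap \<le> \<dots>" .
  \<comment> \<open>The difference of the two projections has squared Frobenius norm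
    \<open>2 * S\<close>. Cauchy-Schwarz gives \<open>g * S \<le> \<nu> * sqrt (2 * S)\<close>, and
    one factor \<open>S\<close> cancels after squaring.\<close>
  have S_upper: "S \<le> 2 * \<nu>\<^sup>2 / g\<^sup>2"
  proof (cases "S = 0")
    case False
    then have S: "S > 0" using S_nonneg by simp
    have [simp]: "(of_bool B :: real)\<^sup>2 = of_bool B" for B
      by (cases B) auto
    have "(\<Sum>(u, v)\<in>?I \<times> ?I. (p u v - of_bool (u = v) * of_bool (u \<in> K))\<^sup>2)
       = (\<Sum>u\<in>?I. (\<Sum>v\<in>?I. (p u v)\<^sup>2) - 2 * (\<Sum>v\<in>?I. of_bool (u = v) * (p u v * of_bool (u \<in> K)))
            + (\<Sum>v\<in>?I. of_bool (u = v) * of_bool (u \<in> K)))"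
      by (simp add: sum.cartesian_product[symmetric] power2_diff power_mult_distrib sum.distrib
          sum_subtractf sum_distrib_left mult_ac del: of_bool_eq)
    also have "\<dots> = (\<Sum>u\<in>?I. p u u - 2 * (p u u * of_bool (u \<in> K)) + of_bool (u \<in> K))"
      by (intro sum.cong refl arg_cong2[where f = "(+)"] arg_cong2[where f = "(-)"]
          arg_cong2[where f = "(*)"] row_sum p_idempotent)
    also have "\<dots> = (\<Sum>u\<in>K. q u u) + (\<Sum>u\<in>J. p u u)"
    proof -
      have 1: "p u u - 2 * (p u u * of_bool (u \<in> K)) + of_bool (u \<in> K) = q u u" if "u \<in> K" for u
        using that p_plus_q[of u u] by simp
      have 2: "p u u - 2 * (p u u * of_bool (u \<in> K)) + of_bool (u \<in> K) = p u u" if "u \<in> J" for u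
        using that disjoint by auto
      show ?thesis unfolding sum_split by (intro arg_cong2[where f = "(+)"] sum.cong refl 1 2)
    qed
    finally have PD: "(\<Sum>(u, v)\<in>?I \<times> ?I. (p u v - of_bool (u = v) * of_bool (u \<in> K))\<^sup>2) = 2 * S"
      using S_eq_sum_q S_def by simp
    have "(g * S)\<^sup>2 \<le> gap\<^sup>2" using lower g S by (intro power_mono) auto
    also have "\<dots> \<le> (\<Sum>(u, v)\<in>?I \<times> ?I. E u v * (p u v - of_bool (u = v) * of_bool (u \<in> K)))\<^sup>2"
      using gap_le lower g S by (intro power_mono order_trans[OF _ lower]) auto
    also have "\<dots> \<le> (\<Sum>(u, v)\<in>?I \<times> ?I. (E u v)\<^sup>2) * (2 * S)"
      using Cauchy_Schwarz_ineq_sum[of "\<lambda>z. E (fst z) (snd z)"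
          "\<lambda>z. p (fst z) (snd z) - of_bool (fst z = snd z) * of_bool (fst z \<in> K)" "?I \<times> ?I"]
      by (simp add: PD[symmetric] case_prod_unfold)
    also have "\<dots> \<le> \<nu>\<^sup>2 * (2 * S)"
      using N S by (intro mult_right_mono) (auto simp: sum.cartesian_product)
    finally have "g\<^sup>2 * S * S \<le> 2 * \<nu>\<^sup>2 * S" by (simp add: power2_eq_square mult_ac)
    then have "g\<^sup>2 * S \<le> 2 * \<nu>\<^sup>2" using S by (simp only: mult_le_cancel_right_pos)
    then show ?thesis using g by (simp add: field_simps)
  qed simp
  have E_row: "(\<Sum>v\<in>?I. (E u v)\<^sup>2) \<le> \<nu>\<^sup>2" if "u \<in> ?I" for u
    by (rule order_trans[OF member_le_sum[OF that] N]) (auto intro: sum_nonneg simp: finite)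
  have E_sym: "E u v = E v u" if "u \<in> ?I" "v \<in> ?I" for u v
    using that by (simp add: E mult.commute)
  have E_abs: "\<bar>E u v\<bar> \<le> \<nu>" if "u \<in> ?I" "v \<in> ?I" for u v
  proof -
    have "(E u v)\<^sup>2 \<le> \<nu>\<^sup>2"
      by (rule order_trans[OF member_le_sum[OF that(2)] E_row[OF that(1)]]) (auto simp: finite)
    then show ?thesis using \<nu> by (simp add: abs_le_square_iff[symmetric])
  qed
  \<comment> \<open>3 / 2 is the square root of the 2 in \<open>S_upper\<close>, rounded up.\<close>
  have small: "\<bar>\<Sum>v\<in>?I. a v * d v\<bar> \<le> 3 / 2 * \<nu>\<^sup>2 / g"
    if a: "(\<Sum>v\<in>?I. (a v)\<^sup>2) \<le> \<nu>\<^sup>2" and d: "(\<Sum>v\<in>?I. (d v)\<^sup>2) \<le> S" for a d :: "'i \<Rightarrow> real"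
  proof -
    have "(\<Sum>v\<in>?I. a v * d v)\<^sup>2 \<le> (\<Sum>v\<in>?I. (a v)\<^sup>2) * (\<Sum>v\<in>?I. (d v)\<^sup>2)"
      by (rule Cauchy_Schwarz_ineq_sum)
    also have "\<dots> \<le> \<nu>\<^sup>2 * (2 * \<nu>\<^sup>2 / g\<^sup>2)"
      using a d S_upper by (intro mult_mono) (auto intro: sum_nonneg)
    also have "\<dots> \<le> (3 / 2 * \<nu>\<^sup>2 / g)\<^sup>2"
      using g \<nu> by (simp add: power2_eq_square divide_simps)
    finally show ?thesis using g by (simp add: abs_le_square_iff[symmetric])
  qed
  \<comment> \<open>With \<open>E\<close>, \<open>p\<close>, \<open>q\<close> as matrices, entry
    \<open>(j, i)\<close> minus entry \<open>(i, j)\<close> of \<open>E p\<close> is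
    \<open>(s i - s j) * p i j\<close>, and \<open>E i j\<close> is the sum of the entries
    \<open>(j, i)\<close> of \<open>E p\<close> and \<open>E q\<close>. What remains pairs rows of
    \<open>E\<close> with row \<open>i\<close> of \<open>q\<close> and row \<open>j\<close> of
    \<open>p\<close>, whose squared norms \<open>q i i\<close> and \<open>p j j\<close> are at most
    \<open>S\<close>.\<close>
  have "\<bar>(s i - s j) * p i j - E i j\<bar> \<le> 3 * \<nu>\<^sup>2 / g" if ij: "i \<in> K" "j \<in> J" for i j
  proof -
    have Ep: "(\<Sum>v\<in>?I. E u v * p v w) = (\<Sum>l\<in>K. t l * (c u l * c w l)) - s u * p u w" if "u \<in> ?I" for u w
    proof -
      have "(\<Sum>v\<in>?I. E u v * p v w)
          = (\<Sum>v\<in>?I. Ab u v * p v w) - (\<Sum>v\<in>?I. of_bool (u = v) * (s u * p v w))"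
        unfolding sum_subtractf[symmetric] using that
        by (intro sum.cong refl) (simp add: E Ab_def left_diff_distrib right_diff_distrib mult_ac)
      then show ?thesis using row_sum[OF that] Ab_p by simp
    qed
    have "(\<Sum>v\<in>?I. E j v * p v i) + (\<Sum>v\<in>?I. E j v * q v i) = (\<Sum>v\<in>?I. of_bool (v = i) * E j v)"
      unfolding sum.distrib[symmetric] distrib_left[symmetric] using ij
      by (intro sum.cong refl) (simp add: p_plus_q)
    also have "\<dots> = E i j" using ij E_sym[of i j] by (subst sum_of_bool_left) auto
    finally have "(\<Sum>v\<in>?I. E j v * p v i) + (\<Sum>v\<in>?I. E j v * q v i) = E i j" .
    moreover have "(\<Sum>v\<in>?I. E j v * q v i) = (\<Sum>v\<in>?I. E j v * q i v)"
      by (subst q_commute) (rule refl)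
    moreover have "(\<Sum>v\<in>?I. E i v * p v j) = (\<Sum>v\<in>?I. E i v * p j v)"
      by (subst p_commute) (rule refl)
    moreover have "(\<Sum>l\<in>K. t l * (c j l * c i l)) = (\<Sum>l\<in>K. t l * (c i l * c j l))"
      by (simp add: mult.commute)
    moreover have "(s i - s j) * p i j = s i * p i j - s j * p j i"
      by (simp add: left_diff_distrib p_commute[of j i])
    ultimately have "(s i - s j) * p i j - E i j
        = - (\<Sum>v\<in>?I. E j v * q i v) - (\<Sum>v\<in>?I. E i v * p j v)"
      using Ep[of j i] Ep[of i j] ij by simp
    moreover have "\<bar>\<Sum>v\<in>?I. E j v * q i v\<bar> \<le> 3 / 2 * \<nu>\<^sup>2 / g"
    proof (rule small)
      show "(\<Sum>v\<in>?I. (q i v)\<^sup>2) \<le> S" unfolding q_idempotent S_eq_sum_q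
        using ij finite q_diag_nonneg by (intro member_le_sum) auto
    qed (use E_row ij in auto)
    moreover have "\<bar>\<Sum>v\<in>?I. E i v * p j v\<bar> \<le> 3 / 2 * \<nu>\<^sup>2 / g"
    proof (rule small)
      show "(\<Sum>v\<in>?I. (p j v)\<^sup>2) \<le> S" unfolding p_idempotent S_def
        using ij finite p_diag_nonneg by (intro member_le_sum) auto
    qed (use E_row ij in auto)
    ultimately show ?thesis by linarith
  qed
  note commutator = this
  have term_bound: "(s i - s j) * (p i j)\<^sup>2 \<le> (E i j)\<^sup>2 / (s i - s j) + (6 * \<nu> ^ 3 / g\<^sup>2 + 9 * \<nu> ^ 4 / g ^ 3)"
    if ij: "i \<in> K" "j \<in> J" for i j
  proof -
    define D where "D = s i - s j"
    have D: "g \<le> D" "0 < D" using s(1)[OF ij(1)] s(2)[OF ij(2)] g by (auto simp: D_def)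
    have "\<bar>D * p i j\<bar> \<le> \<bar>E i j\<bar> + 3 * \<nu>\<^sup>2 / g" using commutator[OF ij] unfolding D_def by linarith
    then have "(D * p i j)\<^sup>2 \<le> (\<bar>E i j\<bar> + 3 * \<nu>\<^sup>2 / g)\<^sup>2"
      by (metis abs_ge_zero power2_abs power_mono)
    also have "\<dots> = (E i j)\<^sup>2 + (2 * \<bar>E i j\<bar> * (3 * \<nu>\<^sup>2 / g) + (3 * \<nu>\<^sup>2 / g)\<^sup>2)"
      by (simp add: power2_sum)
    also have "2 * \<bar>E i j\<bar> * (3 * \<nu>\<^sup>2 / g) \<le> 2 * \<nu> * (3 * \<nu>\<^sup>2 / g)"
      using E_abs[of i j] ij g by (intro mult_right_mono mult_left_mono) auto
    finally have "(D * p i j)\<^sup>2 \<le> (E i j)\<^sup>2 + (2 * \<nu> * (3 * \<nu>\<^sup>2 / g) + (3 * \<nu>\<^sup>2 / g)\<^sup>2)" by simp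
    then have "(D * p i j)\<^sup>2 / D \<le> (E i j)\<^sup>2 / D + (2 * \<nu> * (3 * \<nu>\<^sup>2 / g) + (3 * \<nu>\<^sup>2 / g)\<^sup>2) / D"
      using D by (metis add_divide_distrib divide_right_mono less_imp_le)
    also have "(2 * \<nu> * (3 * \<nu>\<^sup>2 / g) + (3 * \<nu>\<^sup>2 / g)\<^sup>2) / D \<le> (2 * \<nu> * (3 * \<nu>\<^sup>2 / g) + (3 * \<nu>\<^sup>2 / g)\<^sup>2) / g"
      using D g \<nu> by (intro divide_left_mono) auto
    also have "\<dots> = 6 * \<nu> ^ 3 / g\<^sup>2 + 9 * \<nu> ^ 4 / g ^ 3"
      using g by (simp add: field_simps power2_eq_square power3_eq_cube power4_eq_xxxx)
    finally have "(D * p i j)\<^sup>2 / D \<le> (E i j)\<^sup>2 / D + (6 * \<nu> ^ 3 / g\<^sup>2 + 9 * \<nu> ^ 4 / g ^ 3)" by simp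
    moreover have "(D * p i j)\<^sup>2 / D = D * (p i j)\<^sup>2" using D by (simp add: power2_eq_square)
    ultimately show ?thesis unfolding D_def by simp
  qed
  have "gap \<le> (\<Sum>i\<in>K. \<Sum>j\<in>J. (s i - s j) * (p i j)\<^sup>2) + b * S\<^sup>2"
    unfolding gap_def by (rule gap_upper) (use s_bounds b in auto)
  also have "(\<Sum>i\<in>K. \<Sum>j\<in>J. (s i - s j) * (p i j)\<^sup>2)
      \<le> (\<Sum>i\<in>K. \<Sum>j\<in>J. (E i j)\<^sup>2 / (s i - s j) + (6 * \<nu> ^ 3 / g\<^sup>2 + 9 * \<nu> ^ 4 / g ^ 3))"
    by (intro sum_mono term_bound)
  also have "\<dots> = (\<Sum>i\<in>K. \<Sum>j\<in>J. (E i j)\<^sup>2 / (s i - s j))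
      + real (card K * card J) * (6 * \<nu> ^ 3 / g\<^sup>2 + 9 * \<nu> ^ 4 / g ^ 3)"
    by (simp add: sum.distrib)
  also have "b * S\<^sup>2 \<le> b * (2 * \<nu>\<^sup>2 / g\<^sup>2)\<^sup>2"
    using S_upper S_nonneg b by (intro mult_left_mono power_mono)
  also have "\<dots> = 4 * b * \<nu> ^ 4 / g ^ 4"
    by (simp add: power_divide power_mult_distrib)
  finally show ?thesis unfolding gap_def by simp
qed

end

section \<open>Right singular systems as orthonormal eigenbases\<close>

lemma norm_matrix_vector_mult_le: "norm (A *v x) \<le> norm A * norm (x :: real^'a)" for A :: "real^'a^'b"
proof -
  have "(norm (A *v x))\<^sup>2 = (\<Sum>i\<in>UNIV. (A $ i \<bullet> x)\<^sup>2)"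
    by (simp add: norm_vec_def L2_set_def sum_nonneg matrix_vector_mul_component)
  also have "\<dots> \<le> (\<Sum>i\<in>UNIV. (norm (A $ i) * norm x)\<^sup>2)"
    by (intro sum_mono) (metis Cauchy_Schwarz_ineq2 abs_ge_zero power2_abs power_mono)
  also have "\<dots> = (norm A * norm x)\<^sup>2"
    by (simp add: norm_vec_def[of A] L2_set_def sum_nonneg power_mult_distrib sum_distrib_right)
  finally show ?thesis by (rule power2_le_imp_le) simp
qed

lemma inner_transpose_mult: "u \<bullet> (transpose A *v v) = (A *v u) \<bullet> v" for A :: "real^'a^'b"
  using dot_lmul_matrix[of v A u] by (simp add: inner_commute)

lemma orthonormal_parseval:
  fixes \<phi> :: "nat \<Rightarrow> real^'a"
  assumes \<phi>: "orthonormal_columns CARD('a) \<phi>"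
  shows "(\<Sum>i=1..CARD('a). (u \<bullet> \<phi> i) * (v \<bullet> \<phi> i)) = u \<bullet> v"
proof -
  let ?I = "{1..CARD('a)}"
  let ?X = "\<phi> ` ?I"
  have ip: "\<phi> i \<bullet> \<phi> j = of_bool (i = j)" if "i \<in> ?I" "j \<in> ?I" for i j
    using \<phi> that by (simp add: orthonormal_columns_def)
  have inj: "inj_on \<phi> ?I" 
  proof (rule inj_onI)
    fix i j assume "i \<in> ?I" "j \<in> ?I" "\<phi> i = \<phi> j"
    then show "i = j" using ip[of i j] ip[of i i] by (simp split: if_splits)
  qed
  have orth: "pairwise orthogonal ?X"
    by (auto simp: pairwise_def orthogonal_def ip)
  have norm1: "norm x = 1" if "x \<in> ?X" for x
    using that ip by (auto simp: norm_eq_1)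
  have "independent ?X"
    by (rule pairwise_orthogonal_independent[OF orth]) (use norm1 in force)
  moreover have "card ?X = CARD('a)" using card_image[OF inj] by simp
  ultimately have "span ?X = UNIV"
    by (intro equalityI subset_UNIV card_ge_dim_independent) auto
  then have "(\<Sum>x\<in>?X. (u \<bullet> x) *\<^sub>R x) = u"
    using orth norm1 by (intro orthonormal_basis_expand) auto
  then have "u = (\<Sum>i\<in>?I. (u \<bullet> \<phi> i) *\<^sub>R \<phi> i)"
    unfolding sum.reindex[OF inj] o_def by (rule sym)
  then have "u \<bullet> v = (\<Sum>i\<in>?I. (u \<bullet> \<phi> i) *\<^sub>R \<phi> i) \<bullet> v" by simp
  then show ?thesis by (simp add: inner_sum_left inner_commute[of v])
qed

lemma right_singular_system_orthonormal:
  "right_singular_system (A :: real^'a^'b) \<sigma> \<phi> \<Longrightarrow> orthonormal_columns CARD('a) \<phi>"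
  by (simp add: right_singular_system_def orthonormal_columns_def)

lemma right_singular_system_inner:
  fixes A :: "real^'a^'b"
  assumes A: "right_singular_system A \<sigma> \<phi>"
  shows "(A *v u) \<bullet> (A *v v) = (\<Sum>i=1..CARD('a). (\<sigma> i)\<^sup>2 * ((u \<bullet> \<phi> i) * (v \<bullet> \<phi> i)))"
proof -
  have 1: "(A *v w) \<bullet> (A *v z) = w \<bullet> ((transpose A ** A) *v z)" for w z
    unfolding matrix_vector_mul_assoc[symmetric] inner_transpose_mult ..
  have 2: "((transpose A ** A) *v v) \<bullet> \<phi> i = (\<sigma> i)\<^sup>2 * (v \<bullet> \<phi> i)" if "i \<in> {1..CARD('a)}" for i
  proof -
    have "((transpose A ** A) *v v) \<bullet> \<phi> i = v \<bullet> ((transpose A ** A) *v \<phi> i)"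
      using 1[of v "\<phi> i"] 1[of "\<phi> i" v] by (metis inner_commute)
    then show ?thesis using A that by (simp add: right_singular_system_def)
  qed
  show ?thesis
    unfolding 1 orthonormal_parseval[OF right_singular_system_orthonormal[OF A],
        of u "(transpose A ** A) *v v", symmetric]
    by (intro sum.cong refl) (simp add: 2)
qed

lemma frobenius_norm_mult_squared:
  "(frobenius_norm_mult A k \<Psi>)\<^sup>2 = (\<Sum>i=1..k. (A *v \<Psi> i) \<bullet> (A *v \<Psi> i))"
proof -
  have "(frobenius_norm_mult A k \<Psi>)\<^sup>2 = (\<Sum>y\<in>UNIV. \<Sum>i=1..k. ((A *v \<Psi> i) $ y)\<^sup>2)"
    unfolding frobenius_norm_mult_def by (intro real_sqrt_pow2 sum_nonneg zero_le_power2)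
  also have "\<dots> = (\<Sum>i=1..k. \<Sum>y\<in>UNIV. ((A *v \<Psi> i) $ y)\<^sup>2)"
    by (rule sum.swap)
  finally show ?thesis by (simp add: inner_vec_def power2_eq_square)
qed

text \<open>This is \<open>perturbation_bound\<close> for
  \<open>c u l = \<phi> u \<bullet> \<psi> l\<close>, with \<open>E\<close> the change of
  \<open>transpose A ** A\<close> in the basis \<phi>. The entrywise bound \<eta> on
  \<open>E\<close>, which has \<open>CARD('a)\<close> rows and columns, gives the Frobenius bound
  \<nu>. Ties of \<open>A'\<close> are harmless, since its blocks only have to be weakly
  separated.\<close>

lemma top_singular_gap_bound:
  fixes A A' :: "real^'a^'b"
  assumes A: "right_singular_system A \<sigma> \<phi>" and A': "right_singular_system A' \<tau> \<psi>"
    and k: "1 \<le> k" "k < CARD('a)" and g: "0 < g" "g \<le> (\<sigma> k)\<^sup>2 - (\<sigma> (k + 1))\<^sup>2" and b: "(\<sigma> 1)\<^sup>2 \<le> b"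
    and E: "\<And>u v. E u v = (A' *v \<phi> u) \<bullet> (A' *v \<phi> v) - (A *v \<phi> u) \<bullet> (A *v \<phi> v)"
    and E_le: "\<And>u v. u \<in> {1..CARD('a)} \<Longrightarrow> v \<in> {1..CARD('a)} \<Longrightarrow> \<bar>E u v\<bar> \<le> \<eta>"
    and \<eta>: "\<eta> \<ge> 0" and \<nu>: "\<nu> = real CARD('a) * \<eta>"
  shows "(frobenius_norm_mult A k \<phi>)\<^sup>2 - (frobenius_norm_mult A k \<psi>)\<^sup>2
    \<le> (\<Sum>i=1..k. \<Sum>j=k+1..CARD('a). (E i j)\<^sup>2 / ((\<sigma> i)\<^sup>2 - (\<sigma> j)\<^sup>2))
      + ((real CARD('a))\<^sup>2 * (6 * \<nu> ^ 3 / g\<^sup>2 + 9 * \<nu> ^ 4 / g ^ 3) + 4 * b * \<nu> ^ 4 / g ^ 4)"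
proof -
  let ?K = "{1..k}" and ?J = "{k+1..CARD('a)}" and ?I = "{1..CARD('a)}"
  have I: "?K \<union> ?J = ?I" using k by auto
  note o\<phi> = right_singular_system_orthonormal[OF A] and o\<psi> = right_singular_system_orthonormal[OF A']
  have mono: "(\<sigma> j)\<^sup>2 \<le> (\<sigma> i)\<^sup>2" if "1 \<le> i" "i \<le> j" "j \<le> CARD('a)" for i j
    using A that unfolding right_singular_system_def by (intro power_mono) auto
  have mono': "(\<tau> j)\<^sup>2 \<le> (\<tau> i)\<^sup>2" if "1 \<le> i" "i \<le> j" "j \<le> CARD('a)" for i j
    using A' that unfolding right_singular_system_def by (intro power_mono) auto
  have \<phi>\<phi>: "\<phi> u \<bullet> \<phi> v = of_bool (u = v)" if "u \<in> ?I" "v \<in> ?I" for u v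
    using o\<phi> that by (simp add: orthonormal_columns_def)
  have \<psi>\<psi>: "\<psi> u \<bullet> \<psi> v = of_bool (u = v)" if "u \<in> ?I" "v \<in> ?I" for u v
    using o\<psi> that by (simp add: orthonormal_columns_def)
  have \<phi>\<psi>: "\<phi> u \<bullet> \<psi> l = \<psi> l \<bullet> \<phi> u" for u l
    by (rule inner_commute)
  interpret orthogonal_coefficients "\<lambda>u l. \<phi> u \<bullet> \<psi> l" ?K ?J
  proof
    show "(\<Sum>l\<in>?K \<union> ?J. (\<phi> u \<bullet> \<psi> l) * (\<phi> v \<bullet> \<psi> l)) = of_bool (u = v)" if "u \<in> ?K \<union> ?J" "v \<in> ?K \<union> ?J" for u v
      using that unfolding I orthonormal_parseval[OF o\<psi>] by (rule \<phi>\<phi>)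
    show "(\<Sum>u\<in>?K \<union> ?J. (\<phi> u \<bullet> \<psi> l) * (\<phi> u \<bullet> \<psi> m)) = of_bool (l = m)" if "l \<in> ?K \<union> ?J" "m \<in> ?K \<union> ?J" for l m
      using that unfolding I \<phi>\<psi> orthonormal_parseval[OF o\<phi>] by (rule \<psi>\<psi>)
  qed auto
  have inner_A\<phi>: "(A *v \<phi> u) \<bullet> (A *v \<phi> v) = (\<sigma> u)\<^sup>2 * of_bool (u = v)" if "u \<in> ?I" "v \<in> ?I" for u v
  proof -
    have "(A *v \<phi> u) \<bullet> (A *v \<phi> v) = (\<Sum>i\<in>?I. of_bool (i = u) * ((\<sigma> i)\<^sup>2 * of_bool (v = i)))"
      unfolding right_singular_system_inner[OF A] using that
      by (intro sum.cong refl) (auto simp: \<phi>\<phi>)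
    also have "\<dots> = (\<sigma> u)\<^sup>2 * of_bool (v = u)"
      using sum_of_bool_left[of u] that unfolding I by simp
    finally show ?thesis by (simp add: eq_commute)
  qed
  have "(\<Sum>i\<in>?K. (\<sigma> i)\<^sup>2) - (\<Sum>l\<in>?K. \<Sum>u\<in>?K \<union> ?J. (\<sigma> u)\<^sup>2 * (\<phi> u \<bullet> \<psi> l)\<^sup>2)
    \<le> (\<Sum>i\<in>?K. \<Sum>j\<in>?J. (E i j)\<^sup>2 / ((\<sigma> i)\<^sup>2 - (\<sigma> j)\<^sup>2))
      + (real (card ?K * card ?J) * (6 * \<nu> ^ 3 / g\<^sup>2 + 9 * \<nu> ^ 4 / g ^ 3) + 4 * b * \<nu> ^ 4 / g ^ 4)"
  proof (rule perturbation_bound[where m = "(\<sigma> k)\<^sup>2" and m' = "(\<tau> k)\<^sup>2" and t = "\<lambda>l. (\<tau> l)\<^sup>2"])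
    show "b \<ge> 0" using b by (meson order_trans zero_le_power2)
    show "(\<sigma> k)\<^sup>2 \<le> (\<sigma> i)\<^sup>2" if "i \<in> ?K" for i using mono[of i k] that k by simp
    show "(\<sigma> j)\<^sup>2 \<le> (\<sigma> k)\<^sup>2 - g" if "j \<in> ?J" for j using mono[of "k+1" j] that k g by simp
    show "(\<sigma> i)\<^sup>2 \<le> b" if "i \<in> ?K" for i using mono[of 1 i] that k b by simp
    show "(\<tau> k)\<^sup>2 \<le> (\<tau> i)\<^sup>2" if "i \<in> ?K" for i using mono'[of i k] that k by simp
    show "(\<tau> j)\<^sup>2 \<le> (\<tau> k)\<^sup>2" if "j \<in> ?J" for j using mono'[of k j] that k by simp
    show "E u v = (\<Sum>l\<in>?K \<union> ?J. (\<tau> l)\<^sup>2 * ((\<phi> u \<bullet> \<psi> l) * (\<phi> v \<bullet> \<psi> l))) - (\<sigma> u)\<^sup>2 * of_bool (u = v)"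
      if "u \<in> ?K \<union> ?J" "v \<in> ?K \<union> ?J" for u v
      using that unfolding E I by (simp add: inner_A\<phi> right_singular_system_inner[OF A'])
    have "(E u v)\<^sup>2 \<le> \<eta>\<^sup>2" if "u \<in> ?I" "v \<in> ?I" for u v
      using E_le[OF that] \<eta> by (simp add: abs_le_square_iff[symmetric])
    then have "(\<Sum>u\<in>?I. \<Sum>v\<in>?I. (E u v)\<^sup>2) \<le> (\<Sum>u\<in>?I. \<Sum>v\<in>?I. \<eta>\<^sup>2)" by (intro sum_mono)
    then show "(\<Sum>u\<in>?K \<union> ?J. \<Sum>v\<in>?K \<union> ?J. (E u v)\<^sup>2) \<le> \<nu>\<^sup>2"
      unfolding I by (simp add: \<nu> power2_eq_square mult_ac)
  qed (use g \<eta> \<nu> in auto)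
  moreover have "(frobenius_norm_mult A k \<phi>)\<^sup>2 = (\<Sum>i\<in>?K. (\<sigma> i)\<^sup>2)"
    unfolding frobenius_norm_mult_squared using k by (intro sum.cong refl) (simp add: inner_A\<phi>)
  moreover have "(frobenius_norm_mult A k \<psi>)\<^sup>2 = (\<Sum>l\<in>?K. \<Sum>u\<in>?K \<union> ?J. (\<sigma> u)\<^sup>2 * (\<phi> u \<bullet> \<psi> l)\<^sup>2)"
    unfolding frobenius_norm_mult_squared right_singular_system_inner[OF A] I
    by (simp add: power2_eq_square inner_commute)
  moreover have "real (card ?K * card ?J) * (6 * \<nu> ^ 3 / g\<^sup>2 + 9 * \<nu> ^ 4 / g ^ 3)
      \<le> (real CARD('a))\<^sup>2 * (6 * \<nu> ^ 3 / g\<^sup>2 + 9 * \<nu> ^ 4 / g ^ 3)"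
  proof (rule mult_right_mono)
    have "card ?K * card ?J \<le> CARD('a) * CARD('a)" using k by (intro mult_mono) auto
    then show "real (card ?K * card ?J) \<le> (real CARD('a))\<^sup>2"
      by (metis of_nat_le_iff of_nat_mult power2_eq_square)
  qed (use g \<eta> \<nu> in auto)
  ultimately show ?thesis by linarith
qed

section \<open>The estimate as a function of the empirical deviations\<close>

lemma PX_eq_sum: "PX P x = (\<Sum>y\<in>UNIV. pmf P (x, y))" for P :: "('x \<times> 'y::finite) pmf"
proof -
  have "PX P x = measure_pmf.prob P (Pair x ` UNIV)"
    unfolding PX_def pmf_map by (intro arg_cong[of _ _ "measure_pmf.prob P"]) auto
  also have "\<dots> = (\<Sum>z\<in>Pair x ` UNIV. pmf P z)"
    by (intro measure_measure_pmf_finite) simp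
  finally show ?thesis by (simp add: sum.reindex inj_on_def)
qed

lemma PY_eq_sum: "PY P y = (\<Sum>x\<in>UNIV. pmf P (x, y))" for P :: "('x::finite \<times> 'y) pmf"
proof -
  have "PY P y = measure_pmf.prob P ((\<lambda>x. (x, y)) ` UNIV)"
    unfolding PY_def pmf_map by (intro arg_cong[of _ _ "measure_pmf.prob P"]) auto
  also have "\<dots> = (\<Sum>z\<in>(\<lambda>x. (x, y)) ` UNIV. pmf P z)"
    by (intro measure_measure_pmf_finite) simp
  finally show ?thesis by (simp add: sum.reindex inj_on_def)
qed

lemma PX_nonneg: "PX P x \<ge> 0"
  by (simp add: PX_def)

lemma sum_UNIV_prod: "(\<Sum>p\<in>UNIV. f p) = (\<Sum>x\<in>UNIV. \<Sum>y\<in>UNIV. f (x, y))"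
  for f :: "'x::finite \<times> 'y::finite \<Rightarrow> real"
  unfolding sum.cartesian_product UNIV_Times_UNIV by simp

lemma sum_of_bool_eq: "(\<Sum>x\<in>UNIV. of_bool (a = x) * f x) = (f a :: real)" for a :: "'a::finite"
proof -
  have "(\<Sum>x\<in>UNIV. of_bool (a = x) * f x) = (\<Sum>x\<in>UNIV. if a = x then f x else 0)"
    by (intro sum.cong) auto
  then show ?thesis by simp
qed

text \<open>The products \<open>sqrt (pmf P z) * v $ z\<close> are changes of probabilities, and the
  inner sums are changes of the marginals. In these terms the row has the form of the derivative in
  \<open>has_derivative_normalized\<close>.\<close>

lemma L_mat_apply:
  fixes P :: "('x::finite \<times> 'y::finite) pmf"
  shows "(L_mat P *v v) $ (x, y) = 1 / sqrt (PX P x * PY P y) *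
    (sqrt (pmf P (x, y)) * v $ (x, y) - 1 / 2 * (pmf P (x, y) + PX P x * PY P y) *
      ((\<Sum>y'\<in>UNIV. sqrt (pmf P (x, y')) * v $ (x, y')) / PX P x
       + (\<Sum>x'\<in>UNIV. sqrt (pmf P (x', y)) * v $ (x', y)) / PY P y))"
proof -
  define h where "h x' y' = sqrt (pmf P (x', y')) * v $ (x', y')" for x' y'
  define K where "K = 1 / sqrt (PX P x * PY P y)"
  define M where "M = 1 / 2 * (pmf P (x, y) + PX P x * PY P y)"
  have "(L_mat P *v v) $ (x, y)
      = (\<Sum>x'\<in>UNIV. \<Sum>y'\<in>UNIV. K * (of_bool (x = x') * (of_bool (y = y') * h x' y'))
          - K * M / PX P x * (of_bool (x = x') * h x' y') - K * M / PY P y * (of_bool (y = y') * h x' y'))"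
    unfolding matrix_vector_mul_component inner_vec_def sum_UNIV_prod
    by (intro sum.cong refl)
      (simp add: L_mat_def K_def M_def h_def real_sqrt_divide algebra_simps add_divide_distrib)
  also have "\<dots> = K * (\<Sum>x'\<in>UNIV. of_bool (x = x') * (\<Sum>y'\<in>UNIV. of_bool (y = y') * h x' y'))
      - K * M / PX P x * (\<Sum>x'\<in>UNIV. of_bool (x = x') * (\<Sum>y'\<in>UNIV. h x' y'))
      - K * M / PY P y * (\<Sum>x'\<in>UNIV. \<Sum>y'\<in>UNIV. of_bool (y = y') * h x' y')"
    by (simp only: sum_subtractf sum_distrib_left)
  also have "\<dots> = K * h x y - K * M / PX P x * (\<Sum>y'\<in>UNIV. h x y') - K * M / PY P y * (\<Sum>x'\<in>UNIV. h x' y)"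
    by (simp only: sum_of_bool_eq)
  also have "\<dots> = K * (h x y - M * ((\<Sum>y'\<in>UNIV. h x y') / PX P x + (\<Sum>x'\<in>UNIV. h x' y) / PY P y))"
    by (simp add: right_diff_distrib distrib_left)
  finally show ?thesis unfolding h_def K_def M_def .
qed

lemma sum_UNIV_sum: "(\<Sum>c\<in>UNIV. f c) = (\<Sum>a\<in>UNIV. f (Inl a)) + (\<Sum>b\<in>UNIV. f (Inr b))"
  for f :: "'a::finite + 'b::finite \<Rightarrow> real"
  by (subst UNIV_Plus_UNIV[symmetric], subst sum.Plus) simp_all

text \<open>Multiplied by \<open>sqrt (pmf P (x, y))\<close>, the row becomes the change of the
  estimated joint probability: the change seen in the labeled sample, with the fraction
  \<open>r / (1 + r)\<close> of its marginal part replaced by that of the unlabeled sample.\<close>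

lemma L_bar_apply:
  fixes P :: "('x::finite \<times> 'y::finite) pmf"
  assumes PX: "\<And>x. PX P x > 0"
  shows "sqrt (pmf P (x, y)) * (L_bar P r *v w) $ (x, y)
    = sqrt (pmf P (x, y)) * w $ Inl (x, y)
      - r / (1 + r) * (pmf P (x, y) / PX P x) * (\<Sum>y'\<in>UNIV. sqrt (pmf P (x, y')) * w $ Inl (x, y'))
      + sqrt r / (1 + r) * (pmf P (x, y) / sqrt (PX P x)) * w $ Inr x"
proof -
  have "(L_bar P r *v w) $ (x, y)
      = (\<Sum>x'\<in>UNIV. \<Sum>y'\<in>UNIV. of_bool (x = x') * (of_bool (y = y') * w $ Inl (x', y'))
          - r / (1 + r) * (of_bool (x = x') * (sqrt (PYX P y x * PYX P y' x') * w $ Inl (x', y'))))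
        + (\<Sum>x'\<in>UNIV. sqrt r / (1 + r) * sqrt (PYX P y x) * (of_bool (x = x') * w $ Inr x'))"
    unfolding matrix_vector_mul_component inner_vec_def sum_UNIV_sum sum_UNIV_prod
    by (intro arg_cong2[where f = "(+)"] sum.cong refl) (simp_all add: L_bar_def algebra_simps)
  also have "\<dots> = (\<Sum>x'\<in>UNIV. of_bool (x = x') * (\<Sum>y'\<in>UNIV. of_bool (y = y') * w $ Inl (x', y')))
      - r / (1 + r) * (\<Sum>x'\<in>UNIV. of_bool (x = x') * (\<Sum>y'\<in>UNIV. sqrt (PYX P y x * PYX P y' x') * w $ Inl (x', y')))
      + sqrt r / (1 + r) * sqrt (PYX P y x) * (\<Sum>x'\<in>UNIV. of_bool (x = x') * w $ Inr x')"
    by (simp only: sum_subtractf sum_distrib_left)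
  also have "\<dots> = w $ Inl (x, y)
      - r / (1 + r) * (\<Sum>y'\<in>UNIV. sqrt (PYX P y x * PYX P y' x) * w $ Inl (x, y'))
      + sqrt r / (1 + r) * sqrt (PYX P y x) * w $ Inr x"
    by (simp only: sum_of_bool_eq)
  finally have *: "(L_bar P r *v w) $ (x, y) = \<dots>" .
  have "sqrt (pmf P (x, y)) * (\<Sum>y'\<in>UNIV. sqrt (PYX P y x * PYX P y' x) * w $ Inl (x, y'))
      = pmf P (x, y) / PX P x * (\<Sum>y'\<in>UNIV. sqrt (pmf P (x, y')) * w $ Inl (x, y'))"
    unfolding sum_distrib_left using PX[of x]
    by (intro sum.cong refl) (simp add: PYX_def real_sqrt_mult real_sqrt_divide)
  moreover have "sqrt (pmf P (x, y)) * sqrt (PYX P y x) = pmf P (x, y) / sqrt (PX P x)"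
    by (simp add: PYX_def real_sqrt_divide)
  ultimately show ?thesis unfolding * by (simp add: algebra_simps)
qed

text \<open>
  The estimated quantities as functions of the normalized deviation \<open>w\<close> of the two empirical
  distributions: \<open>w $ Inl (x, y)\<close> stands for \<open>(Q - P) / sqrt P\<close> at \<open>(x, y)\<close> and \<open>w $ Inr x\<close> for
  \<open>sqrt r * (Q - P) / sqrt P\<close> at \<open>x\<close>. In these coordinates twice the relative entropies per labeled
  sample sum up to the squared norm of \<open>w\<close>, to second order.
\<close>

definition PXY_at :: "('x::finite \<times> 'y::finite) pmf \<Rightarrow> real^('x \<times> 'y + 'x) \<Rightarrow> 'x \<Rightarrow> 'y \<Rightarrow> real" where
  "PXY_at P w x y = pmf P (x, y) + sqrt (pmf P (x, y)) * w $ Inl (x, y)"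

definition QX_at :: "('x::finite \<times> 'y::finite) pmf \<Rightarrow> real \<Rightarrow> real^('x \<times> 'y + 'x) \<Rightarrow> 'x \<Rightarrow> real" where
  "QX_at P r w x = PX P x + sqrt (PX P x) / sqrt r * w $ Inr x"

definition PX_hat_at :: "('x::finite \<times> 'y::finite) pmf \<Rightarrow> real^('x \<times> 'y + 'x) \<Rightarrow> 'x \<Rightarrow> real" where
  "PX_hat_at P w x = (\<Sum>y\<in>UNIV. PXY_at P w x y)"

definition PX_bar_at :: "('x::finite \<times> 'y::finite) pmf \<Rightarrow> real \<Rightarrow> real^('x \<times> 'y + 'x) \<Rightarrow> 'x \<Rightarrow> real" where
  "PX_bar_at P r w x = 1 / (1 + r) * PX_hat_at P w x + r / (1 + r) * QX_at P r w x"

definition PXY_bar_at :: "('x::finite \<times> 'y::finite) pmf \<Rightarrow> real \<Rightarrow> real^('x \<times> 'y + 'x) \<Rightarrow> 'x \<Rightarrow> 'y \<Rightarrow> real" where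
  "PXY_bar_at P r w x y = PXY_at P w x y / PX_hat_at P w x * PX_bar_at P r w x"

definition PY_bar_at :: "('x::finite \<times> 'y::finite) pmf \<Rightarrow> real \<Rightarrow> real^('x \<times> 'y + 'x) \<Rightarrow> 'y \<Rightarrow> real" where
  "PY_bar_at P r w y = (\<Sum>x\<in>UNIV. PXY_bar_at P r w x y)"

definition B_bar_at :: "('x::finite \<times> 'y::finite) pmf \<Rightarrow> real \<Rightarrow> real^('x \<times> 'y + 'x) \<Rightarrow> real^'x^'y" where
  "B_bar_at P r w = (\<chi> y x. PXY_bar_at P r w x y / sqrt (PX_bar_at P r w x * PY_bar_at P r w y)
                          - sqrt (PX_bar_at P r w x * PY_bar_at P r w y))"

definition B_bar_linear :: "('x::finite \<times> 'y::finite) pmf \<Rightarrow> real \<Rightarrow> real^('x \<times> 'y + 'x) \<Rightarrow> real^'x^'y" where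
  "B_bar_linear P r w = (\<chi> y x. (L_mat P *v (L_bar P r *v w)) $ (x, y))"

section \<open>First-order expansion of the estimate\<close>

lemma has_derivative_vec_nth: "((\<lambda>w. w $ i) has_derivative (\<lambda>w. w $ i)) F"
  for F :: "(real^'a) filter"
  by (rule bounded_linear_imp_has_derivative) (rule bounded_linear_vec_nth)

text \<open>With \<open>R = sqrt (a * b)\<close> and the logarithmic derivative
  \<open>z = a' / a + b' / b\<close> of \<open>a * b\<close>, the derivative of \<open>R\<close> is
  \<open>R * z / 2\<close>. Both occurrences of \<open>R\<close> contribute, hence the sum
  \<open>f + a * b\<close> and the factor 1 / 2 in \<open>L_mat\<close>.\<close>

lemma has_derivative_normalized:
  fixes f a b :: "'w::real_normed_vector \<Rightarrow> real"
  assumes f: "(f has_derivative f') (at w)" and a: "(a has_derivative a') (at w)"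
    and b: "(b has_derivative b') (at w)" and pos: "a w > 0" "b w > 0"
  shows "((\<lambda>w. f w / sqrt (a w * b w) - sqrt (a w * b w)) has_derivative
    (\<lambda>h. 1 / sqrt (a w * b w) * (f' h - 1 / 2 * (f w + a w * b w) * (a' h / a w + b' h / b w)))) (at w)"
proof -
  define R where "R = sqrt (a w * b w)"
  have R: "R > 0" "R * R = a w * b w" using pos by (auto simp: R_def)
  have s: "((\<lambda>w. sqrt (a w * b w)) has_derivative (\<lambda>h. (a w * b' h + a' h * b w) / (2 * R))) (at w)"
    by (rule derivative_eq_intros a b refl | use pos in \<open>simp add: R_def field_simps\<close>)+
  have "((\<lambda>w. f w / sqrt (a w * b w) - sqrt (a w * b w)) has_derivative
      (\<lambda>h. (f' h * R - f w * ((a w * b' h + a' h * b w) / (2 * R))) / (R * R) - (a w * b' h + a' h * b w) / (2 * R))) (at w)"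
    unfolding R_def
  proof (rule has_derivative_diff[OF has_derivative_divide'[OF f s[unfolded R_def]] s[unfolded R_def]])
    show "sqrt (a w * b w) \<noteq> 0" using R(1) unfolding R_def by (rule less_imp_neq[symmetric])
  qed
  moreover have "(f' h * R - f w * ((a w * b' h + a' h * b w) / (2 * R))) / (R * R) - (a w * b' h + a' h * b w) / (2 * R)
      = 1 / R * (f' h - 1 / 2 * (f w + a w * b w) * (a' h / a w + b' h / b w))" for h
  proof -
    define z where "z = a' h / a w + b' h / b w"
    have "a w * b' h + a' h * b w = R * R * z"
      using pos unfolding R z_def by (simp add: field_simps)
    then show ?thesis unfolding z_def[symmetric] R(2)[symmetric] using R(1) by (simp add: field_simps)
  qed
  ultimately show ?thesis unfolding R_def by simp
qed

context
  fixes P :: "('x::finite \<times> 'y::finite) pmf" and r :: real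
  assumes PX_pos: "\<And>x. PX P x > 0" and PY_pos: "\<And>y. PY P y > 0" and r: "r > 0"
begin

lemma estimates_at_zero:
  "PXY_at P 0 x y = pmf P (x, y)" "PX_hat_at P 0 x = PX P x" "PX_bar_at P r 0 x = PX P x"
  "PXY_bar_at P r 0 x y = pmf P (x, y)" "PY_bar_at P r 0 y = PY P y"
proof -
  show 1: "PXY_at P 0 x y = pmf P (x, y)" for x y by (simp add: PXY_at_def)
  show 2: "PX_hat_at P 0 x = PX P x" for x by (simp add: PX_hat_at_def 1 PX_eq_sum)
  show 3: "PX_bar_at P r 0 x = PX P x" for x
  proof -
    have "1 / (1 + r) + r / (1 + r) = 1" using r by (simp add: field_simps)
    then have "1 / (1 + r) * p + r / (1 + r) * p = p" for p
      by (metis distrib_right mult_1)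
    then show ?thesis by (simp only: PX_bar_at_def 2 QX_at_def) simp
  qed
  show 4: "PXY_bar_at P r 0 x y = pmf P (x, y)" for x y
    using PX_pos[of x] by (simp add: PXY_bar_at_def 1 2 3)
  show "PY_bar_at P r 0 y = PY P y" by (simp add: PY_bar_at_def 4 PY_eq_sum)
qed

lemma B_bar_at_zero: "B_bar_at P r 0 = B_tilde P"
proof -
  have "a / sqrt (b * c) - sqrt (b * c) = (a - b * c) / sqrt (b * c)" if "b * c > 0" for a b c :: real
    using that by (simp add: diff_divide_distrib real_div_sqrt)
  then show ?thesis using PX_pos PY_pos by (simp add: B_bar_at_def B_tilde_def estimates_at_zero)
qed

lemma PXY_at_derivative: "((\<lambda>w. PXY_at P w x y) has_derivative (\<lambda>w. sqrt (pmf P (x, y)) * w $ Inl (x, y))) (at 0)"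
  unfolding PXY_at_def by (auto intro!: derivative_eq_intros has_derivative_vec_nth)

lemma PX_hat_at_derivative:
  "((\<lambda>w. PX_hat_at P w x) has_derivative (\<lambda>w. \<Sum>y\<in>UNIV. sqrt (pmf P (x, y)) * w $ Inl (x, y))) (at 0)"
  unfolding PX_hat_at_def by (intro has_derivative_sum PXY_at_derivative)

lemma PX_bar_at_derivative_explicit:
  "((\<lambda>w. PX_bar_at P r w x) has_derivative
    (\<lambda>w. 1 / (1 + r) * (\<Sum>y\<in>UNIV. sqrt (pmf P (x, y)) * w $ Inl (x, y))
       + r / (1 + r) * (sqrt (PX P x) / sqrt r * w $ Inr x))) (at 0)"
proof -
  have "((\<lambda>w. QX_at P r w x) has_derivative (\<lambda>w. sqrt (PX P x) / sqrt r * w $ Inr x)) (at 0)"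
    unfolding QX_at_def
    by (rule has_derivative_eq_rhs[OF has_derivative_add[OF has_derivative_const
            has_derivative_mult_right[OF has_derivative_vec_nth]]]) simp
  then show ?thesis
    unfolding PX_bar_at_def by (intro has_derivative_add has_derivative_mult_right PX_hat_at_derivative)
qed

lemma sqrt_rescale: "r / (1 + r) * (s / sqrt r * u) = sqrt r / (1 + r) * s * u"
proof -
  have "r / sqrt r = sqrt r" using r by (simp add: real_div_sqrt)
  then show ?thesis by (metis (no_types, opaque_lifting) mult.assoc mult.commute times_divide_eq_left times_divide_eq_right)
qed

lemma PXY_bar_at_derivative:
  "((\<lambda>w. PXY_bar_at P r w x y) has_derivative (\<lambda>w. sqrt (pmf P (x, y)) * (L_bar P r *v w) $ (x, y))) (at 0)"
proof -
  define p where "p = PX P x"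
  have p: "p > 0" using PX_pos by (simp add: p_def)
  define S where "S w = (\<Sum>y\<in>UNIV. sqrt (pmf P (x, y)) * w $ Inl (x, y))" for w :: "real^('x \<times> 'y + 'x)"
  define U where "U w = r / (1 + r) * (sqrt p / sqrt r * w $ Inr x)" for w :: "real^('x \<times> 'y + 'x)"
  have 1: "((\<lambda>w. PXY_at P w x y / PX_hat_at P w x) has_derivative
      (\<lambda>w. (sqrt (pmf P (x, y)) * w $ Inl (x, y) * p - pmf P (x, y) * S w) / (p * p))) (at 0)"
    using has_derivative_divide'[OF PXY_at_derivative[of x y] PX_hat_at_derivative[of x]] p
    by (simp add: estimates_at_zero p_def S_def)
  have "((\<lambda>w. PXY_bar_at P r w x y) has_derivative
     (\<lambda>w. pmf P (x, y) / p * (1 / (1 + r) * S w + U w)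
        + (sqrt (pmf P (x, y)) * w $ Inl (x, y) * p - pmf P (x, y) * S w) / (p * p) * p)) (at 0)"
    using has_derivative_mult[OF 1 PX_bar_at_derivative_explicit[of x]]
    unfolding PXY_bar_at_def by (simp add: estimates_at_zero p_def S_def U_def)
  moreover have "pmf P (x, y) / p * (1 / (1 + r) * S w + U w)
        + (sqrt (pmf P (x, y)) * w $ Inl (x, y) * p - pmf P (x, y) * S w) / (p * p) * p
      = sqrt (pmf P (x, y)) * (L_bar P r *v w) $ (x, y)" for w
  proof -
    have U: "U w = sqrt r / (1 + r) * sqrt p * w $ Inr x" unfolding U_def by (rule sqrt_rescale)
    have sp: "pmf P (x, y) / sqrt p = pmf P (x, y) / p * sqrt p"
      using p by (simp add: field_simps)
    \<comment> \<open>The labeled marginal enters with coefficient \<open>1 / (1 + r)\<close>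
      through the mixed marginal and with -1 through the division by \<open>PX_hat_at\<close>; the
      balance is the coefficient \<open>- r / (1 + r)\<close> of \<open>L_bar\<close>.\<close>
    have i: "1 / (1 + r) = 1 - r / (1 + r)" using r by (simp add: field_simps)
    have d: "(sqrt (pmf P (x, y)) * w $ Inl (x, y) * p - pmf P (x, y) * S w) / (p * p) * p
        = sqrt (pmf P (x, y)) * w $ Inl (x, y) - pmf P (x, y) / p * S w"
      using p by (simp add: field_simps)
    show ?thesis
      unfolding L_bar_apply[OF PX_pos] p_def[symmetric] S_def[symmetric] U sp d i
      by (simp only: algebra_simps)
  qed
  ultimately show ?thesis by simp
qed

text \<open>Brings the derivative into the form in which \<open>L_mat_apply\<close> contains the
  marginal. It reflects that near 0 the joint estimate has \<open>PX_bar_at\<close> as its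
  marginal.\<close>

lemma PX_bar_at_derivative:
  "((\<lambda>w. PX_bar_at P r w x) has_derivative
    (\<lambda>w. \<Sum>y\<in>UNIV. sqrt (pmf P (x, y)) * (L_bar P r *v w) $ (x, y))) (at 0)"
proof -
  define p where "p = PX P x"
  have p: "p > 0" using PX_pos by (simp add: p_def)
  have "(\<Sum>y\<in>UNIV. sqrt (pmf P (x, y)) * (L_bar P r *v w) $ (x, y))
      = 1 / (1 + r) * (\<Sum>y\<in>UNIV. sqrt (pmf P (x, y)) * w $ Inl (x, y))
         + r / (1 + r) * (sqrt (PX P x) / sqrt r * w $ Inr x)" for w
  proof -
    define S where "S = (\<Sum>y\<in>UNIV. sqrt (pmf P (x, y)) * w $ Inl (x, y))"
    have "(\<Sum>y\<in>UNIV. sqrt (pmf P (x, y)) * (L_bar P r *v w) $ (x, y))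
        = S - r / (1 + r) * (p / p) * S + sqrt r / (1 + r) * (p / sqrt p) * w $ Inr x"
      unfolding L_bar_apply[OF PX_pos] p_def PX_eq_sum[of P x] S_def
      by (simp add: sum.distrib sum_subtractf flip: sum_distrib_right sum_distrib_left sum_divide_distrib)
    also have "\<dots> = 1 / (1 + r) * S + sqrt r / (1 + r) * sqrt p * w $ Inr x"
      using p r by (simp add: real_div_sqrt field_simps)
    finally show ?thesis unfolding sqrt_rescale S_def p_def .
  qed
  then show ?thesis using PX_bar_at_derivative_explicit[of x] by simp
qed

lemma PY_bar_at_derivative:
  "((\<lambda>w. PY_bar_at P r w y) has_derivative
    (\<lambda>w. \<Sum>x\<in>UNIV. sqrt (pmf P (x, y)) * (L_bar P r *v w) $ (x, y))) (at 0)"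
  unfolding PY_bar_at_def by (intro has_derivative_sum PXY_bar_at_derivative)

lemma B_bar_at_derivative: "(B_bar_at P r has_derivative B_bar_linear P r) (at 0)"
proof -
  have "((\<lambda>w. B_bar_at P r w $ y $ x) has_derivative (\<lambda>w. B_bar_linear P r w $ y $ x)) (at 0)" for x y
    using has_derivative_normalized[OF PXY_bar_at_derivative[of x y] PX_bar_at_derivative[of x] PY_bar_at_derivative[of y]]
      PX_pos[of x] PY_pos[of y]
    unfolding B_bar_at_def B_bar_linear_def by (simp add: estimates_at_zero L_mat_apply)
  then show ?thesis
    by (subst has_derivative_componentwise_within)
      (auto simp: Basis_vec_def inner_axis)
qed

text \<open>The estimator is tied to singular vectors only where these denominators do not vanish.
  The derivatives already computed yield continuity at 0.\<close>

lemma nonvanishing_near_zero: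
  "\<exists>d>0. \<forall>w. norm w < d \<longrightarrow>
    (\<forall>x. PX_hat_at P w x \<noteq> 0) \<and> (\<forall>x. PX_bar_at P r w x \<noteq> 0) \<and> (\<forall>y. PY_bar_at P r w y \<noteq> 0)"
proof -
  have ne: "\<forall>\<^sub>F w in nhds 0. f w \<noteq> 0" if "(f has_derivative f') (at 0)" "f 0 > 0"
    for f f' :: "real^('x \<times> 'y + 'x) \<Rightarrow> real"
  proof -
    have "(f \<longlongrightarrow> f 0) (nhds 0)"
      using has_derivative_continuous[OF that(1)] by (simp add: isCont_def tendsto_at_iff_tendsto_nhds)
    then have "\<forall>\<^sub>F w in nhds 0. f w > 0" using that(2) by (rule order_tendstoD)
    then show ?thesis by eventually_elim simp
  qed
  have "\<forall>\<^sub>F w in nhds 0. (\<forall>x. PX_hat_at P w x \<noteq> 0) \<and> (\<forall>x. PX_bar_at P r w x \<noteq> 0) \<and> (\<forall>y. PY_bar_at P r w y \<noteq> 0)"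
    by (intro eventually_conj eventually_all_finite ne[OF PX_hat_at_derivative]
        ne[OF PX_bar_at_derivative] ne[OF PY_bar_at_derivative])
      (auto simp: estimates_at_zero PX_pos PY_pos)
  then show ?thesis by (simp add: eventually_nhds_metric dist_norm)
qed

end

section \<open>The constant alpha_bar\<close>

lemma sum_matrix_vector_mult: "(\<Sum>i\<in>I. f i) *v x = (\<Sum>i\<in>I. f i *v x)" for f :: "'i \<Rightarrow> real^'a^'b"
  by (induction I rule: infinite_finite_induct) (simp_all add: matrix_vector_mult_add_rdistrib)

lemma outer_mult: "outer u v *v x = (v \<bullet> x) *\<^sub>R u"
  by (simp add: vec_eq_iff outer_def matrix_vector_mult_def inner_vec_def sum_distrib_right mult_ac sum_distrib_left)

text \<open>Reading \<open>v\<close> as a matrix \<open>D\<close>, the pairing is the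
  \<open>(i, j)\<close> entry, in the basis \<phi>, of the derivative of
  \<open>transpose B ** B\<close> at \<open>B_tilde P\<close> in direction \<open>D\<close>. This is
  what the vectors \<open>theta\<close> encode.\<close>

lemma theta_inner:
  fixes P :: "('x::finite \<times> 'y::finite) pmf"
  shows "theta P \<phi> i j \<bullet> v = ((\<chi> y x. v $ (x, y)) *v \<phi> i) \<bullet> (B_tilde P *v \<phi> j)
    + (B_tilde P *v \<phi> i) \<bullet> ((\<chi> y x. v $ (x, y)) *v \<phi> j)"
proof -
  have kron: "kron a b \<bullet> v = ((\<chi> y x. v $ (x, y)) *v a) \<bullet> b" for a :: "real^'x" and b :: "real^'y"
  proof -
    have "kron a b \<bullet> v = (\<Sum>x\<in>UNIV. \<Sum>y\<in>UNIV. a $ x * b $ y * v $ (x, y))"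
      by (simp add: inner_vec_def sum_UNIV_prod kron_def)
    also have "\<dots> = (\<Sum>y\<in>UNIV. \<Sum>x\<in>UNIV. a $ x * b $ y * v $ (x, y))" by (rule sum.swap)
    also have "\<dots> = ((\<chi> y x. v $ (x, y)) *v a) \<bullet> b"
      by (simp add: inner_vec_def matrix_vector_mult_def sum_distrib_left sum_distrib_right mult_ac)
    finally show ?thesis .
  qed
  show ?thesis unfolding theta_def inner_add_left kron by (simp add: inner_commute)
qed

text \<open>The first-order change of the \<open>(i, j)\<close> entry of \<open>transpose B ** B\<close> in the basis \<open>\<phi>\<close>.\<close>

definition first_order ::
    "('x::finite \<times> 'y::finite) pmf \<Rightarrow> real \<Rightarrow> (nat \<Rightarrow> real^'x) \<Rightarrow> real^('x \<times> 'y + 'x) \<Rightarrow> nat \<Rightarrow> nat \<Rightarrow> real" where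
  "first_order P r \<phi> w i j = (B_bar_linear P r w *v \<phi> i) \<bullet> (B_tilde P *v \<phi> j) + (B_tilde P *v \<phi> i) \<bullet> (B_bar_linear P r w *v \<phi> j)"

text \<open>\<open>G_mat\<close> carries the weights of the main term in
  \<open>perturbation_bound\<close>, so the form is that main term with the first-order change in
  place of \<open>E\<close>.\<close>

lemma G_bar_quadratic_form:
  fixes P :: "('x::finite \<times> 'y::finite) pmf"
  shows "w \<bullet> ((transpose (L_bar P r) ** G_mat P \<sigma> \<phi> k ** L_bar P r) *v w)
    = (\<Sum>i=1..k. \<Sum>j=k+1..CARD('x). (first_order P r \<phi> w i j)\<^sup>2 / ((\<sigma> i)\<^sup>2 - (\<sigma> j)\<^sup>2))"
proof -
  define v where "v = L_mat P *v (L_bar P r *v w)"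
  let ?M = "\<Sum>i=1..k. \<Sum>j=k+1..CARD('x).
    (1 / ((\<sigma> i)\<^sup>2 - (\<sigma> j)\<^sup>2)) *\<^sub>R outer (theta P \<phi> i j) (theta P \<phi> i j)"
  have "w \<bullet> ((transpose (L_bar P r) ** G_mat P \<sigma> \<phi> k ** L_bar P r) *v w) = v \<bullet> (?M *v v)"
    unfolding G_mat_def v_def matrix_vector_mul_assoc[symmetric] inner_transpose_mult ..
  also have "\<dots> = (\<Sum>i=1..k. \<Sum>j=k+1..CARD('x). (theta P \<phi> i j \<bullet> v)\<^sup>2 / ((\<sigma> i)\<^sup>2 - (\<sigma> j)\<^sup>2))"
    by (simp add: sum_matrix_vector_mult inner_sum_right scaleR_matrix_vector_assoc[symmetric]
        outer_mult inner_commute power2_eq_square)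
  finally show ?thesis by (simp add: theta_inner first_order_def B_bar_linear_def v_def)
qed

lemma first_order_le_alpha:
  fixes P :: "('x::finite \<times> 'y::finite) pmf"
  shows "(\<Sum>i=1..k. \<Sum>j=k+1..CARD('x). (first_order P r \<phi> w i j)\<^sup>2 / ((\<sigma> i)\<^sup>2 - (\<sigma> j)\<^sup>2))
    \<le> alpha_bar P \<sigma> \<phi> k r * (norm w)\<^sup>2"
proof -
  let ?G = "transpose (L_bar P r) ** G_mat P \<sigma> \<phi> k ** L_bar P r"
  have "w \<bullet> (?G *v w) \<le> norm w * norm (?G *v w)" by (rule norm_cauchy_schwarz)
  also have "\<dots> \<le> norm w * (alpha_bar P \<sigma> \<phi> k r * norm w)"
    unfolding alpha_bar_def by (intro mult_left_mono onorm matrix_vector_mul_bounded_linear) simp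
  finally show ?thesis unfolding G_bar_quadratic_form by (simp add: power2_eq_square mult_ac)
qed

lemma right_singular_system_norm:
  assumes A: "right_singular_system A \<sigma> \<phi>" and i: "i \<in> {1..CARD('a)}"
  shows "(norm ((A :: real^'a^'b) *v \<phi> i))\<^sup>2 = (\<sigma> i)\<^sup>2" and "norm (\<phi> i) = 1"
proof -
  have ip: "\<phi> i \<bullet> \<phi> j = of_bool (i = j)" if "j \<in> {1..CARD('a)}" for j
    using A i that by (simp add: right_singular_system_def)
  show "norm (\<phi> i) = 1" using ip[OF i] by (simp add: norm_eq_1)
  have "(norm (A *v \<phi> i))\<^sup>2 = (\<Sum>j\<in>{1..CARD('a)}. if i = j then (\<sigma> j)\<^sup>2 else 0)"
    unfolding power2_norm_eq_inner right_singular_system_inner[OF A]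
    by (intro sum.cong refl) (simp add: ip)
  then show "(norm (A *v \<phi> i))\<^sup>2 = (\<sigma> i)\<^sup>2" using i by simp
qed

text \<open>
  If \<open>alpha_bar\<close> vanished, no sample size would be required, so positivity is essential. It holds
  because \<open>(sqrt (PX P x))\<^sub>x\<close> lies in the kernel both of \<open>B_tilde\<close> and (with the estimated marginal) of
  its estimates: moving the marginal in the direction of \<open>\<phi> 1\<close> turns the kernel towards \<open>\<phi> 1\<close>.
\<close>

lemma alpha_bar_lower:
  fixes P :: "('x::finite \<times> 'y::finite) pmf"
  assumes PX: "\<And>x. PX P x > 0" and PY: "\<And>y. PY P y > 0" and r: "r > 0"
    and sys: "right_singular_system (B_tilde P) \<sigma> \<phi>" and k: "1 \<le> k" "k < CARD('x)"
    and gap: "\<sigma> (k + 1) < \<sigma> k"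
  shows "r / (4 * (1 + r)\<^sup>2) * (\<sigma> 1)\<^sup>2 \<le> alpha_bar P \<sigma> \<phi> k r"
proof -
  let ?I = "{1..CARD('x)}"
  define sq :: "real^'x" where "sq = (\<chi> x. sqrt (PX P x))"
  define c where "c = sqrt r / (1 + r)"
  \<comment> \<open>The labeled sample is left unperturbed; a unit deviation is put on the unlabeled
    marginal.\<close>
  define w :: "real^('x \<times> 'y + 'x)" where "w = (\<chi> a. case a of Inl _ \<Rightarrow> 0 | Inr x \<Rightarrow> \<phi> 1 $ x)"
  let ?B = "B_tilde P" and ?D = "B_bar_linear P r w"
  have one: "1 \<in> ?I" using k by simp
  have nn: "\<sigma> j \<ge> 0" if "j \<in> ?I" for j using sys that by (simp add: right_singular_system_def)
  have mono: "\<sigma> j \<le> \<sigma> i" if "i \<in> ?I" "j \<in> ?I" "i \<le> j" for i j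
    using sys that by (simp add: right_singular_system_def)
  have \<sigma>k: "\<sigma> k > 0" using gap nn[of "k + 1"] k by simp
  have pos: "\<sigma> i > 0" if "i \<in> {1..k}" for i
    using \<sigma>k mono[of i k] that k by fastforce
  have \<sigma>1: "\<sigma> 1 > 0" using pos[of 1] k by simp
  have sumP: "(\<Sum>x\<in>UNIV. PX P x) = 1" unfolding PX_def by (rule sum_pmf_eq_1) auto
  have norm_w: "norm w = 1"
    using right_singular_system_norm(2)[OF sys one]
    by (simp add: norm_vec_def L2_set_def w_def sum_UNIV_sum)
  have sq: "sq \<bullet> sq = 1" using sumP by (simp add: sq_def inner_vec_def PX_nonneg)
  have Bsq: "?B *v sq = 0"
  proof (rule vec_eq_iff[THEN iffD2], intro allI)
    fix y
    have "(?B *v sq) $ y = (\<Sum>x\<in>UNIV. (pmf P (x, y) - PX P x * PY P y) / sqrt (PY P y))"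
      unfolding matrix_vector_mul_component inner_vec_def using PX
      by (intro sum.cong refl) (simp add: sq_def B_tilde_def real_sqrt_mult less_imp_neq[symmetric])
    also have "\<dots> = 0"
      by (simp add: sum_divide_distrib[symmetric] sum_subtractf sum_distrib_right[symmetric] sumP PY_eq_sum)
    finally show "(?B *v sq) $ y = 0 $ y" by simp
  qed
  have "(\<Sum>j\<in>?I. (\<sigma> j)\<^sup>2 * ((sq \<bullet> \<phi> j) * (sq \<bullet> \<phi> j))) = 0"
    using right_singular_system_inner[OF sys, of sq sq] by (simp add: Bsq)
  then have "\<forall>j\<in>?I. (\<sigma> j)\<^sup>2 * ((sq \<bullet> \<phi> j) * (sq \<bullet> \<phi> j)) = 0"
    by (subst (asm) sum_nonneg_eq_0_iff) auto
  then have kernel: "sq \<bullet> \<phi> j = 0" if "j \<in> ?I" "\<sigma> j \<noteq> 0" for j using that by auto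
  have sq\<phi>: "(\<Sum>x\<in>UNIV. sqrt (PX P x) * \<phi> 1 $ x) = 0"
    using kernel[OF one] \<sigma>1 by (simp add: sq_def inner_vec_def)
  \<comment> \<open>This is the derivative of the kernel relation. The square root of the estimated
    marginal moves by \<open>c / 2\<close> times \<open>\<phi> 1\<close> to first order, so
    \<open>?D *v sq\<close> must cancel \<open>?B\<close> applied to that. The calculation checks it
    coordinatewise.\<close>
  have Dsq: "?D *v sq = (- c / 2) *\<^sub>R (?B *v \<phi> 1)"
  proof (rule vec_eq_iff[THEN iffD2], intro allI)
    fix y
    define s where "s x = sqrt (PX P x)" for x
    define t where "t = sqrt (PY P y)"
    define f where "f x = \<phi> 1 $ x" for x
    have s: "s x > 0" "PX P x = s x * s x" for x using PX[of x] by (auto simp: s_def)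
    have t: "t > 0" "PY P y = t * t" using PY[of y] by (auto simp: t_def)
    define F where "F x y = sqrt (pmf P (x, y)) * (L_bar P r *v w) $ (x, y)" for x y
    have F: "F x y = c * f x / s x * pmf P (x, y)" for x y
      unfolding F_def L_bar_apply[OF PX] by (simp add: w_def c_def f_def s_def)
    have FX: "(\<Sum>y'\<in>UNIV. F x y') = c * f x * s x" for x
      unfolding F sum_distrib_left[symmetric] PX_eq_sum[symmetric] s(2) using s(1)[of x] by simp
    define Y where "Y = (\<Sum>x\<in>UNIV. F x y)"
    have D: "?D $ y $ x = 1 / (s x * t) * (F x y - 1 / 2 * (pmf P (x, y) + PX P x * PY P y) *
        (c * f x * s x / PX P x + Y / PY P y))" for x
      unfolding B_bar_linear_def vec_lambda_beta L_mat_apply F_def[symmetric] FX Y_def[symmetric]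
      by (simp add: real_sqrt_mult s_def t_def)
    have "(?D *v sq) $ y = (\<Sum>x\<in>UNIV. ?D $ y $ x * s x)"
      by (simp add: matrix_vector_mul_component inner_vec_def sq_def s_def)
    also have "\<dots> = (\<Sum>x\<in>UNIV. F x y / t - Y / (2 * t) * (pmf P (x, y) / PY P y) - Y / (2 * t) * PX P x
        - c / 2 * ((pmf P (x, y) - PX P x * PY P y) / (s x * t) * f x) - c * t * (s x * f x))"
    proof (intro sum.cong refl)
      fix x
      show "?D $ y $ x * s x = F x y / t - Y / (2 * t) * (pmf P (x, y) / PY P y) - Y / (2 * t) * PX P x
        - c / 2 * ((pmf P (x, y) - PX P x * PY P y) / (s x * t) * f x) - c * t * (s x * f x)"
        unfolding D s(2) t(2) using s(1)[of x] t(1) by (simp add: field_simps)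
    qed
    also have "\<dots> = Y / t - Y / (2 * t) * ((\<Sum>x\<in>UNIV. pmf P (x, y)) / PY P y) - Y / (2 * t) * (\<Sum>x\<in>UNIV. PX P x)
        - c / 2 * (\<Sum>x\<in>UNIV. (pmf P (x, y) - PX P x * PY P y) / (s x * t) * f x) - c * t * (\<Sum>x\<in>UNIV. s x * f x)"
      unfolding Y_def by (simp only: sum_subtractf sum_distrib_left sum_divide_distrib)
    also have "\<dots> = - (c / 2) * (\<Sum>x\<in>UNIV. (pmf P (x, y) - PX P x * PY P y) / (s x * t) * f x)"
      using sq\<phi> PY[of y] by (simp add: sumP PY_eq_sum[symmetric] s_def f_def)
    also have "(\<Sum>x\<in>UNIV. (pmf P (x, y) - PX P x * PY P y) / (s x * t) * f x) = (?B *v \<phi> 1) $ y"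
      by (simp add: matrix_vector_mul_component inner_vec_def B_tilde_def real_sqrt_mult s_def t_def f_def)
    finally show "(?D *v sq) $ y = ((- c / 2) *\<^sub>R (?B *v \<phi> 1)) $ y" by simp
  qed
  \<comment> \<open>If the kernel of \<open>B_tilde\<close> has dimension above 1, \<open>sq\<close>
    may be spread over several indices in \<open>Z\<close>. Their contributions are collected by
    Cauchy-Schwarz, the squared coefficients of \<open>sq\<close> summing up to at most 1.\<close>
  define Z where "Z = {j \<in> ?I. \<sigma> j = 0}"
  have Z: "Z \<subseteq> {k+1..CARD('x)}" using pos by (fastforce simp: Z_def not_less_eq_eq)
  define z where "z j = (?B *v \<phi> 1) \<bullet> (?D *v \<phi> j)" for j
  have "(\<Sum>j\<in>?I. (sq \<bullet> \<phi> j) * z j) = (\<Sum>j\<in>?I. (sq \<bullet> \<phi> j) * ((transpose ?D *v (?B *v \<phi> 1)) \<bullet> \<phi> j))"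
    unfolding z_def by (intro sum.cong refl) (metis inner_commute inner_transpose_mult)
  also have "\<dots> = sq \<bullet> (transpose ?D *v (?B *v \<phi> 1))"
    by (rule orthonormal_parseval[OF right_singular_system_orthonormal[OF sys]])
  also have "\<dots> = - c / 2 * (\<sigma> 1)\<^sup>2"
    unfolding inner_transpose_mult Dsq using right_singular_system_norm(1)[OF sys one]
    by (simp add: power2_norm_eq_inner)
  also have "(\<Sum>j\<in>?I. (sq \<bullet> \<phi> j) * z j) = (\<Sum>j\<in>Z. (sq \<bullet> \<phi> j) * z j)"
    by (rule sum.mono_neutral_right) (use kernel in \<open>auto simp: Z_def\<close>)
  finally have "(- c / 2 * (\<sigma> 1)\<^sup>2)\<^sup>2 = (\<Sum>j\<in>Z. (sq \<bullet> \<phi> j) * z j)\<^sup>2" by simp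
  also have "\<dots> \<le> (\<Sum>j\<in>Z. (sq \<bullet> \<phi> j)\<^sup>2) * (\<Sum>j\<in>Z. (z j)\<^sup>2)" by (rule Cauchy_Schwarz_ineq_sum)
  also have "\<dots> \<le> 1 * (\<Sum>j\<in>Z. (z j)\<^sup>2)"
  proof (intro mult_right_mono sum_nonneg zero_le_power2)
    have "(\<Sum>j\<in>Z. (sq \<bullet> \<phi> j)\<^sup>2) \<le> (\<Sum>j\<in>?I. (sq \<bullet> \<phi> j)\<^sup>2)"
      by (rule sum_mono2) (auto simp: Z_def)
    also have "\<dots> = 1"
      using orthonormal_parseval[OF right_singular_system_orthonormal[OF sys], of sq sq] sq
      by (simp add: power2_eq_square)
    finally show "(\<Sum>j\<in>Z. (sq \<bullet> \<phi> j)\<^sup>2) \<le> 1" .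
  qed
  finally have zZ: "c\<^sup>2 / 4 * ((\<sigma> 1)\<^sup>2 * (\<sigma> 1)\<^sup>2) \<le> (\<Sum>j\<in>Z. (z j)\<^sup>2)"
    by (simp add: power_mult_distrib power_divide power2_eq_square mult_ac)
  have term_nonneg: "0 \<le> (first_order P r \<phi> w i j)\<^sup>2 / ((\<sigma> i)\<^sup>2 - (\<sigma> j)\<^sup>2)"
    if "i \<in> {1..k}" "j \<in> {k+1..CARD('x)}" for i j
    using mono[of i j] nn[of j] that k by (intro divide_nonneg_nonneg) (auto intro: power_mono)
  have c2: "c\<^sup>2 = r / (1 + r)\<^sup>2" using r by (simp add: c_def power_divide)
  have cancel: "c\<^sup>2 / 4 * (a * a) / a = c\<^sup>2 / 4 * a" for a by simp
  have "r / (4 * (1 + r)\<^sup>2) * (\<sigma> 1)\<^sup>2 = c\<^sup>2 / 4 * ((\<sigma> 1)\<^sup>2 * (\<sigma> 1)\<^sup>2) / (\<sigma> 1)\<^sup>2"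
    unfolding cancel unfolding c2 by simp
  also have "\<dots> \<le> (\<Sum>j\<in>Z. (z j)\<^sup>2) / (\<sigma> 1)\<^sup>2"
    using zZ by (intro divide_right_mono) auto
  also have "\<dots> = (\<Sum>j\<in>Z. (first_order P r \<phi> w 1 j)\<^sup>2 / ((\<sigma> 1)\<^sup>2 - (\<sigma> j)\<^sup>2))"
    unfolding sum_divide_distrib
  proof (intro sum.cong refl)
    fix j assume j: "j \<in> Z"
    then have "(norm (?B *v \<phi> j))\<^sup>2 = 0"
      using right_singular_system_norm(1)[OF sys, of j] by (simp add: Z_def)
    then show "(z j)\<^sup>2 / (\<sigma> 1)\<^sup>2 = (first_order P r \<phi> w 1 j)\<^sup>2 / ((\<sigma> 1)\<^sup>2 - (\<sigma> j)\<^sup>2)"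
      using j by (simp add: Z_def first_order_def z_def)
  qed
  also have "\<dots> \<le> (\<Sum>j=k+1..CARD('x). (first_order P r \<phi> w 1 j)\<^sup>2 / ((\<sigma> 1)\<^sup>2 - (\<sigma> j)\<^sup>2))"
    using Z k by (intro sum_mono2 term_nonneg) auto
  also have "\<dots> \<le> (\<Sum>i=1..k. \<Sum>j=k+1..CARD('x). (first_order P r \<phi> w i j)\<^sup>2 / ((\<sigma> i)\<^sup>2 - (\<sigma> j)\<^sup>2))"
    by (rule member_le_sum[of 1 "{1..k}" "\<lambda>i. \<Sum>j=k+1..CARD('x). (first_order P r \<phi> w i j)\<^sup>2 / ((\<sigma> i)\<^sup>2 - (\<sigma> j)\<^sup>2)"])
      (use k in \<open>auto intro!: sum_nonneg term_nonneg\<close>)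
  also have "\<dots> \<le> alpha_bar P \<sigma> \<phi> k r * (norm w)\<^sup>2" by (rule first_order_le_alpha)
  finally show ?thesis using norm_w by simp
qed

text \<open>The radius is chosen before \<open>k\<close> and both singular systems, so it serves
  every \<open>k\<close> and every choice among ties. The perturbation bound is applied to the exact
  change of \<open>transpose B ** B\<close>; passing to its linear part and discarding the terms of
  higher order costs at most \<open>\<kappa> * (norm w)\<^sup>2\<close>.\<close>

lemma gap_near_population:
  fixes P :: "('x::finite \<times> 'y::finite) pmf"
  assumes PX: "\<And>x. PX P x > 0" and PY: "\<And>y. PY P y > 0" and r: "r > 0"
    and g: "g > 0" and \<kappa>: "\<kappa> > 0"
  shows "\<exists>\<eta>>0. \<forall>w k \<sigma> \<phi> \<tau> \<psi>. norm w < \<eta> \<longrightarrow> 1 \<le> k \<longrightarrow> k < CARD('x) \<longrightarrow>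
    right_singular_system (B_tilde P) \<sigma> \<phi> \<longrightarrow> g \<le> (\<sigma> k)\<^sup>2 - (\<sigma> (k + 1))\<^sup>2 \<longrightarrow>
    right_singular_system (B_bar_at P r w) \<tau> \<psi> \<longrightarrow>
    (frobenius_norm_mult (B_tilde P) k \<phi>)\<^sup>2 - (frobenius_norm_mult (B_tilde P) k \<psi>)\<^sup>2
      \<le> (alpha_bar P \<sigma> \<phi> k r + \<kappa>) * (norm w)\<^sup>2"
proof -
  let ?B = "B_tilde P"
  define \<beta> where "\<beta> = norm ?B"
  define d where "d = real CARD('x)"
  have deriv: "(B_bar_at P r has_derivative B_bar_linear P r) (at 0)"
    by (rule B_bar_at_derivative[OF PX PY r])
  obtain C where C: "C > 0" "\<And>w. norm (B_bar_linear P r w) \<le> norm w * C"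
    using bounded_linear.pos_bounded[OF has_derivative_bounded_linear[OF deriv]] by blast
  \<comment> \<open>For \<open>x = norm w\<close> in the final radius, \<open>C1 * x\<close> bounds
    the change of the matrix, \<open>H * x\<close> both the change \<open>E\<close> of
    \<open>transpose B ** B\<close> and its linear part, and \<open>H2 * (\<mu> * x)\<close> their
    difference. \<open>K\<close> collects the coefficients of the error terms, each reduced to a
    multiple of \<open>\<mu> * x\<^sup>2\<close>.\<close>
  define C1 where "C1 = C + 1"
  define H where "H = 2 * \<beta> * C1 + C1\<^sup>2"
  define H2 where "H2 = 2 * \<beta> + C1\<^sup>2"
  define K where "K = d\<^sup>2 * ((2 * H * H2 + H2\<^sup>2) / g)
    + (d\<^sup>2 * (6 * (d * H) ^ 3 / g\<^sup>2 + 9 * (d * H) ^ 4 / g ^ 3) + 4 * \<beta>\<^sup>2 * (d * H) ^ 4 / g ^ 4)"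
  have nonneg: "\<beta> \<ge> 0" "d \<ge> 0" "C1 \<ge> 0" "H \<ge> 0" "H2 \<ge> 0"
    using C by (auto simp: \<beta>_def d_def C1_def H_def H2_def)
  have K: "K \<ge> 0" using nonneg g by (auto simp: K_def)
  \<comment> \<open>\<mu> serves twice: as the tolerance in the differentiability of
    \<open>B_bar_at\<close>, and as a bound on the radius, so that
    \<open>x ^ 3 \<le> \<mu> * x\<^sup>2\<close>.\<close>
  define \<mu> where "\<mu> = min 1 (\<kappa> / (K + 1))"
  have \<mu>: "0 < \<mu>" "\<mu> \<le> 1" using \<kappa> K by (auto simp: \<mu>_def)
  have "K * \<mu> \<le> (K + 1) * (\<kappa> / (K + 1))" using K \<mu> by (intro mult_mono) (auto simp: \<mu>_def)
  then have K\<mu>: "K * \<mu> \<le> \<kappa>" using K by simp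
  obtain \<eta>1 where \<eta>1: "\<eta>1 > 0"
    "\<And>w. norm w < \<eta>1 \<Longrightarrow> norm (B_bar_at P r w - ?B - B_bar_linear P r w) \<le> \<mu> * norm w"
    using deriv \<mu>(1) unfolding has_derivative_at_alt B_bar_at_zero[OF PX PY r] by (metis diff_zero)
  show ?thesis
  proof (intro exI[of _ "min \<eta>1 \<mu>"] conjI allI impI)
    show "min \<eta>1 \<mu> > 0" using \<eta>1 \<mu> by simp
    fix w :: "real^('x \<times> 'y + 'x)" and k \<sigma> \<phi> \<tau> \<psi>
    assume w: "norm w < min \<eta>1 \<mu>" and k: "1 \<le> k" "k < CARD('x)"
      and sys: "right_singular_system ?B \<sigma> \<phi>" and gap: "g \<le> (\<sigma> k)\<^sup>2 - (\<sigma> (k + 1))\<^sup>2"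
      and sys': "right_singular_system (B_bar_at P r w) \<tau> \<psi>"
    define x where "x = norm w"
    have x: "0 \<le> x" "x \<le> \<mu>" "x \<le> 1" using w \<mu> by (auto simp: x_def)
    let ?D = "B_bar_at P r w - ?B" and ?L = "B_bar_linear P r w"
    have DL: "norm (?D - ?L) \<le> \<mu> * x" using \<eta>1(2)[of w] w by (simp add: x_def)
    have L: "norm ?L \<le> C * x" using C(2)[of w] by (simp add: x_def mult.commute)
    have "norm ?D \<le> norm (?D - ?L) + norm ?L" by (metis diff_add_cancel norm_triangle_ineq)
    also have "\<dots> \<le> 1 * x + C * x" using DL L \<mu> x by (intro add_mono order_trans[OF DL] mult_right_mono) auto
    finally have D: "norm ?D \<le> C1 * x" by (simp add: C1_def algebra_simps)
    have \<phi>1: "norm (\<phi> u) = 1" if "u \<in> {1..CARD('x)}" for u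
      using right_singular_system_norm(2)[OF sys that] .
    have mv: "norm (M *v \<phi> u) \<le> norm M" if "u \<in> {1..CARD('x)}" for M :: "real^'x^'y" and u
      using norm_matrix_vector_mult_le[of M "\<phi> u"] \<phi>1[OF that] by simp
    have ip: "\<bar>(M *v \<phi> u) \<bullet> (N *v \<phi> v)\<bar> \<le> a * b"
      if "u \<in> {1..CARD('x)}" "v \<in> {1..CARD('x)}" "norm M \<le> a" "norm N \<le> b"
      for M N :: "real^'x^'y" and u v a b
    proof -
      have "\<bar>(M *v \<phi> u) \<bullet> (N *v \<phi> v)\<bar> \<le> norm (M *v \<phi> u) * norm (N *v \<phi> v)"
        by (rule Cauchy_Schwarz_ineq2)
      also have "\<dots> \<le> a * b"
        using mv[OF that(1), of M] mv[OF that(2), of N] that(3,4)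
        by (intro mult_mono) (auto intro: order_trans[OF norm_ge_zero])
      finally show ?thesis .
    qed
    define E where "E u v = (B_bar_at P r w *v \<phi> u) \<bullet> (B_bar_at P r w *v \<phi> v) - (?B *v \<phi> u) \<bullet> (?B *v \<phi> v)" for u v
    have E_eq: "E u v = (?D *v \<phi> u) \<bullet> (?B *v \<phi> v) + (?B *v \<phi> u) \<bullet> (?D *v \<phi> v) + (?D *v \<phi> u) \<bullet> (?D *v \<phi> v)" for u v
      by (simp add: E_def matrix_vector_mult_diff_rdistrib inner_diff_left inner_diff_right)
    have sq_le: "(C1 * x) * (C1 * x) \<le> C1\<^sup>2 * (a * x)" if "x \<le> a" for a
    proof -
      have "C1\<^sup>2 * (x * x) \<le> C1\<^sup>2 * (a * x)"
        using that x by (intro mult_left_mono mult_right_mono) auto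
      then show ?thesis by (simp add: power2_eq_square mult_ac)
    qed
    have E_le: "\<bar>E u v\<bar> \<le> H * x" if "u \<in> {1..CARD('x)}" "v \<in> {1..CARD('x)}" for u v
    proof -
      have "\<bar>E u v\<bar> \<le> (C1 * x) * \<beta> + \<beta> * (C1 * x) + (C1 * x) * (C1 * x)"
        unfolding E_eq using that D
        by (intro abs_triangle_ineq[THEN order_trans] add_mono ip) (auto simp: \<beta>_def)
      also have "\<dots> \<le> H * x" using sq_le[of 1] x by (simp add: H_def algebra_simps)
      finally show ?thesis .
    qed
    have E_first: "\<bar>E u v - first_order P r \<phi> w u v\<bar> \<le> H2 * (\<mu> * x)" if "u \<in> {1..CARD('x)}" "v \<in> {1..CARD('x)}" for u v
    proof -
      have "E u v - first_order P r \<phi> w u v = ((?D - ?L) *v \<phi> u) \<bullet> (?B *v \<phi> v) + (?B *v \<phi> u) \<bullet> ((?D - ?L) *v \<phi> v)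
          + (?D *v \<phi> u) \<bullet> (?D *v \<phi> v)"
        by (simp add: E_eq first_order_def matrix_vector_mult_diff_rdistrib[of ?D ?L] inner_diff_left inner_diff_right)
      also have "\<bar>\<dots>\<bar> \<le> (\<mu> * x) * \<beta> + \<beta> * (\<mu> * x) + (C1 * x) * (C1 * x)"
        using that D DL by (intro abs_triangle_ineq[THEN order_trans] add_mono ip) (auto simp: \<beta>_def)
      also have "\<dots> \<le> H2 * (\<mu> * x)" using sq_le[OF x(2)] by (simp add: H2_def algebra_simps)
      finally show ?thesis .
    qed
    have first_le: "\<bar>first_order P r \<phi> w u v\<bar> \<le> H * x" if "u \<in> {1..CARD('x)}" "v \<in> {1..CARD('x)}" for u v
    proof -
      have "\<bar>first_order P r \<phi> w u v\<bar> \<le> (C * x) * \<beta> + \<beta> * (C * x)"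
        unfolding first_order_def using that L
        by (intro abs_triangle_ineq[THEN order_trans] add_mono ip) (auto simp: \<beta>_def)
      also have "\<dots> \<le> (C * x) * \<beta> + \<beta> * (C * x) + (2 * \<beta> + C1\<^sup>2) * x" using nonneg x by simp
      also have "\<dots> = H * x" by (simp add: H_def C1_def algebra_simps)
      finally show ?thesis .
    qed
    have term_le: "(E i j)\<^sup>2 / ((\<sigma> i)\<^sup>2 - (\<sigma> j)\<^sup>2)
        \<le> (first_order P r \<phi> w i j)\<^sup>2 / ((\<sigma> i)\<^sup>2 - (\<sigma> j)\<^sup>2) + (2 * H * H2 + H2\<^sup>2) / g * (\<mu> * x\<^sup>2)"
      if ij: "i \<in> {1..k}" "j \<in> {k+1..CARD('x)}" for i j
    proof -
      define f e \<Delta> where "f = first_order P r \<phi> w i j" and "e = E i j - f" and "\<Delta> = (\<sigma> i)\<^sup>2 - (\<sigma> j)\<^sup>2"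
      have mono: "(\<sigma> v)\<^sup>2 \<le> (\<sigma> u)\<^sup>2" if "1 \<le> u" "u \<le> v" "v \<le> CARD('x)" for u v
        using sys that unfolding right_singular_system_def by (intro power_mono) auto
      have \<Delta>: "g \<le> \<Delta>" using gap mono[of i k] mono[of "k + 1" j] ij k by (simp add: \<Delta>_def)
      have f: "\<bar>f\<bar> \<le> H * x" and e: "\<bar>e\<bar> \<le> H2 * (\<mu> * x)"
        using first_le[of i j] E_first[of i j] ij k by (auto simp: f_def e_def)
      have fe: "2 * (\<bar>f\<bar> * \<bar>e\<bar>) \<le> 2 * ((H * x) * (H2 * (\<mu> * x)))"
        using f e nonneg x by (intro mult_left_mono mult_mono) auto
      have "e\<^sup>2 \<le> (H2 * (\<mu> * x))\<^sup>2" using e by (metis abs_ge_zero power2_abs power_mono)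
      also have "\<dots> = H2\<^sup>2 * (\<mu> * \<mu>) * x\<^sup>2" by (simp add: power2_eq_square mult_ac)
      also have "\<dots> \<le> H2\<^sup>2 * (1 * \<mu>) * x\<^sup>2"
        using \<mu> by (intro mult_right_mono mult_left_mono) auto
      finally have ee: "e\<^sup>2 \<le> H2\<^sup>2 * (\<mu> * x\<^sup>2)" by simp
      have "(E i j)\<^sup>2 = f\<^sup>2 + 2 * (f * e) + e\<^sup>2" by (simp add: e_def power2_eq_square algebra_simps)
      also have "\<dots> \<le> f\<^sup>2 + 2 * (\<bar>f\<bar> * \<bar>e\<bar>) + e\<^sup>2" by (simp flip: abs_mult)
      also have "\<dots> \<le> f\<^sup>2 + (2 * H * H2 + H2\<^sup>2) * (\<mu> * x\<^sup>2)"
        using fe ee by (simp add: power2_eq_square algebra_simps)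
      finally have "(E i j)\<^sup>2 / \<Delta> \<le> (f\<^sup>2 + (2 * H * H2 + H2\<^sup>2) * (\<mu> * x\<^sup>2)) / \<Delta>"
        using \<Delta> g by (intro divide_right_mono) auto
      also have "\<dots> = f\<^sup>2 / \<Delta> + (2 * H * H2 + H2\<^sup>2) * (\<mu> * x\<^sup>2) / \<Delta>" by (rule add_divide_distrib)
      also have "(2 * H * H2 + H2\<^sup>2) * (\<mu> * x\<^sup>2) / \<Delta> \<le> (2 * H * H2 + H2\<^sup>2) * (\<mu> * x\<^sup>2) / g"
        using \<Delta> g nonneg \<mu> by (intro divide_left_mono) auto
      finally show ?thesis by (simp add: f_def \<Delta>_def)
    qed
    define \<nu> where "\<nu> = d * (H * x)"
    have "(\<sigma> 1)\<^sup>2 = (norm (?B *v \<phi> 1))\<^sup>2" using right_singular_system_norm(1)[OF sys, of 1] k by simp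
    also have "\<dots> \<le> \<beta>\<^sup>2" using mv[of 1 ?B] k by (intro power_mono) (auto simp: \<beta>_def)
    finally have b: "(\<sigma> 1)\<^sup>2 \<le> \<beta>\<^sup>2" .
    have "(frobenius_norm_mult ?B k \<phi>)\<^sup>2 - (frobenius_norm_mult ?B k \<psi>)\<^sup>2
        \<le> (\<Sum>i=1..k. \<Sum>j=k+1..CARD('x). (E i j)\<^sup>2 / ((\<sigma> i)\<^sup>2 - (\<sigma> j)\<^sup>2))
          + (d\<^sup>2 * (6 * \<nu> ^ 3 / g\<^sup>2 + 9 * \<nu> ^ 4 / g ^ 3) + 4 * \<beta>\<^sup>2 * \<nu> ^ 4 / g ^ 4)"
      unfolding d_def
      by (rule top_singular_gap_bound[OF sys sys' k g gap b E_def E_le])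
        (use nonneg x in \<open>auto simp: \<nu>_def d_def\<close>)
    also have "(\<Sum>i=1..k. \<Sum>j=k+1..CARD('x). (E i j)\<^sup>2 / ((\<sigma> i)\<^sup>2 - (\<sigma> j)\<^sup>2))
        \<le> (\<Sum>i=1..k. \<Sum>j=k+1..CARD('x). (first_order P r \<phi> w i j)\<^sup>2 / ((\<sigma> i)\<^sup>2 - (\<sigma> j)\<^sup>2)
            + (2 * H * H2 + H2\<^sup>2) / g * (\<mu> * x\<^sup>2))"
      by (intro sum_mono term_le)
    also have "\<dots> = (\<Sum>i=1..k. \<Sum>j=k+1..CARD('x). (first_order P r \<phi> w i j)\<^sup>2 / ((\<sigma> i)\<^sup>2 - (\<sigma> j)\<^sup>2))
        + real (k * (CARD('x) - k)) * ((2 * H * H2 + H2\<^sup>2) / g * (\<mu> * x\<^sup>2))"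
      by (simp add: sum.distrib)
    also have "(\<Sum>i=1..k. \<Sum>j=k+1..CARD('x). (first_order P r \<phi> w i j)\<^sup>2 / ((\<sigma> i)\<^sup>2 - (\<sigma> j)\<^sup>2))
        \<le> alpha_bar P \<sigma> \<phi> k r * x\<^sup>2"
      unfolding x_def by (rule first_order_le_alpha)
    also have "real (k * (CARD('x) - k)) * ((2 * H * H2 + H2\<^sup>2) / g * (\<mu> * x\<^sup>2))
        \<le> d\<^sup>2 * ((2 * H * H2 + H2\<^sup>2) / g * (\<mu> * x\<^sup>2))"
    proof (rule mult_right_mono)
      have "k * (CARD('x) - k) \<le> CARD('x) * CARD('x)" using k by (intro mult_mono) auto
      then show "real (k * (CARD('x) - k)) \<le> d\<^sup>2"
        unfolding d_def by (metis of_nat_le_iff of_nat_mult power2_eq_square)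
    qed (use nonneg g \<mu> in auto)
    also have "d\<^sup>2 * (6 * \<nu> ^ 3 / g\<^sup>2 + 9 * \<nu> ^ 4 / g ^ 3) + 4 * \<beta>\<^sup>2 * \<nu> ^ 4 / g ^ 4
        \<le> d\<^sup>2 * (6 * ((d * H) ^ 3 * (\<mu> * x\<^sup>2)) / g\<^sup>2 + 9 * ((d * H) ^ 4 * (\<mu> * x\<^sup>2)) / g ^ 3)
          + 4 * \<beta>\<^sup>2 * ((d * H) ^ 4 * (\<mu> * x\<^sup>2)) / g ^ 4"
    proof -
      have "x * x\<^sup>2 \<le> \<mu> * x\<^sup>2" using x by (intro mult_right_mono) auto
      then have x3: "x ^ 3 \<le> \<mu> * x\<^sup>2" by (simp add: power3_eq_cube power2_eq_square mult_ac)
      have "x * x ^ 3 \<le> 1 * x ^ 3" using x by (intro mult_right_mono) auto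
      then have x4: "x ^ 4 \<le> \<mu> * x\<^sup>2" using x3 by (simp add: power3_eq_cube power4_eq_xxxx mult_ac)
      have \<nu>': "\<nu> = (d * H) * x" by (simp add: \<nu>_def)
      have "\<nu> ^ 3 \<le> (d * H) ^ 3 * (\<mu> * x\<^sup>2)"
        unfolding \<nu>' power_mult_distrib[of "d * H" x]
        using x3 nonneg by (intro mult_left_mono) auto
      moreover have "\<nu> ^ 4 \<le> (d * H) ^ 4 * (\<mu> * x\<^sup>2)"
        unfolding \<nu>' power_mult_distrib[of "d * H" x]
        using x4 nonneg by (intro mult_left_mono) auto
      ultimately show ?thesis
        using g nonneg by (intro add_mono mult_left_mono divide_right_mono) auto
    qed
    finally have "(frobenius_norm_mult ?B k \<phi>)\<^sup>2 - (frobenius_norm_mult ?B k \<psi>)\<^sup>2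
        \<le> alpha_bar P \<sigma> \<phi> k r * x\<^sup>2 + (K * \<mu>) * x\<^sup>2"
      by (simp add: K_def algebra_simps add_divide_distrib)
    also have "\<dots> \<le> alpha_bar P \<sigma> \<phi> k r * x\<^sup>2 + \<kappa> * x\<^sup>2"
      using K\<mu> by (intro add_left_mono mult_right_mono) auto
    finally show "(frobenius_norm_mult ?B k \<phi>)\<^sup>2 - (frobenius_norm_mult ?B k \<psi>)\<^sup>2
        \<le> (alpha_bar P \<sigma> \<phi> k r + \<kappa>) * (norm w)\<^sup>2"
      by (simp add: x_def algebra_simps)
  qed
qed

section \<open>Relative entropy of the samples with large loss\<close>

text \<open>Where \<open>P\<close> vanishes the component is 0 by the convention for division.
  Samples in the support of \<open>P\<close> have frequency 0 there, so nothing is lost.\<close>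

definition deviation ::
    "('x::finite \<times> 'y::finite) pmf \<Rightarrow> real \<Rightarrow> ('x \<times> 'y) list \<Rightarrow> 'x list \<Rightarrow> real^('x \<times> 'y + 'x)" where
  "deviation P r s u = (\<chi> c. case c of
      Inl z \<Rightarrow> (empirical s z - pmf P z) / sqrt (pmf P z)
    | Inr x \<Rightarrow> sqrt r * (empirical u x - PX P x) / sqrt (PX P x))"

lemma empirical_outside: "z \<notin> set s \<Longrightarrow> empirical s z = 0"
  by (simp add: empirical_def)

lemma empirical_le_1: "empirical s z \<le> 1"
  by (cases "s = []") (simp_all add: empirical_def count_le_length)

lemma estimates_at_deviation:
  fixes P :: "('x::finite \<times> 'y::finite) pmf"
  assumes s: "set s \<subseteq> set_pmf P" and PX: "\<And>x. PX P x > 0" and r: "r > 0"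
  shows "PXY_at P (deviation P r s u) = (\<lambda>x y. empirical s (x, y))"
    and "PX_hat_at P (deviation P r s u) = PX_hat s"
    and "QX_at P r (deviation P r s u) = empirical u"
    and "PX_bar_at P r (deviation P r s u) = PX_bar r s u"
    and "PY_bar_at P r (deviation P r s u) = PY_bar r s u"
    and "B_bar_at P r (deviation P r s u) = B_bar r s u"
proof -
  show 1: "PXY_at P (deviation P r s u) = (\<lambda>x y. empirical s (x, y))"
  proof (intro ext)
    fix x y
    show "PXY_at P (deviation P r s u) x y = empirical s (x, y)"
    proof (cases "pmf P (x, y) = 0")
      case True
      then have "(x, y) \<notin> set s" using s by (auto simp: pmf_eq_0_set_pmf)
      then show ?thesis using True by (simp add: PXY_at_def empirical_outside)
    qed (simp add: PXY_at_def deviation_def)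
  qed
  show 2: "PX_hat_at P (deviation P r s u) = PX_hat s"
    by (simp add: fun_eq_iff PX_hat_at_def PX_hat_def 1)
  show 3: "QX_at P r (deviation P r s u) = empirical u"
    using PX r by (simp add: fun_eq_iff QX_at_def deviation_def less_imp_neq[symmetric])
  show 4: "PX_bar_at P r (deviation P r s u) = PX_bar r s u"
    by (simp add: fun_eq_iff PX_bar_at_def PX_bar_def 2 3)
  have 5: "PXY_bar_at P r (deviation P r s u) = PXY_bar r s u"
    by (simp add: fun_eq_iff PXY_bar_at_def PXY_bar_def 1 2 4)
  show 6: "PY_bar_at P r (deviation P r s u) = PY_bar r s u"
    by (simp add: fun_eq_iff PY_bar_at_def PY_bar_def 5)
  show "B_bar_at P r (deviation P r s u) = B_bar r s u"
    by (simp add: B_bar_at_def B_bar_def 4 5 6)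
qed

lemma norm_deviation_le_kl:
  fixes P :: "('x::finite \<times> 'y::finite) pmf"
  assumes ne: "s \<noteq> []" "u \<noteq> []" and r: "r > 0" and R: "R \<ge> 1"
    and le: "\<And>z. empirical s z \<le> R * pmf P z" "\<And>x. empirical u x \<le> R * PX P x"
  shows "(norm (deviation P r s u))\<^sup>2
    \<le> 2 * R * (kl (empirical s) (pmf P) + r * kl (empirical u) (pmf (map_pmf fst P)))"
proof -
  have P1: "(\<Sum>z\<in>UNIV. pmf Q z) = 1" for Q :: "'z::finite pmf"
    by (rule sum_pmf_eq_1) auto
  have "(norm (deviation P r s u))\<^sup>2 = (\<Sum>z\<in>UNIV. (empirical s z - pmf P z)\<^sup>2 / pmf P z)
      + r * (\<Sum>x\<in>UNIV. (empirical u x - PX P x)\<^sup>2 / PX P x)"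
    using r by (simp add: norm_vec_def L2_set_def sum_nonneg sum_UNIV_sum deviation_def power_divide
        power_mult_distrib sum_distrib_left PX_nonneg)
  also have "\<dots> \<le> 2 * R * kl (empirical s) (pmf P) + r * (2 * R * kl (empirical u) (PX P))"
    using le r R ne P1[of "map_pmf fst P"]
    by (intro add_mono mult_left_mono kl_lower)
      (auto simp: P1 sum_empirical empirical_nonneg PX_nonneg PX_def[symmetric])
  also have "PX P = pmf (map_pmf fst P)" by (simp add: fun_eq_iff PX_def)
  finally show ?thesis by (simp add: algebra_simps)
qed

text \<open>\<open>R\<close> bounds the reciprocals of the positive probabilities, which gives
  \<open>sqrt p \<le> sqrt R * p\<close> and turns the normalized deviation into a relative one. The
  factor \<open>c\<close> is 1 for labeled and \<open>1 / sqrt r\<close> for unlabeled samples,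
  undoing the scaling of \<open>deviation\<close>.\<close>

lemma ratio_le_of_deviation:
  fixes p q :: real
  assumes q: "q = p + sqrt p * c * v" and v: "\<bar>v\<bar> \<le> x" and c: "0 \<le> c" and R: "p \<noteq> 0 \<Longrightarrow> 1 \<le> R * p" and p: "p \<ge> 0"
  shows "q \<le> (1 + sqrt R * c * x) * p"
proof (cases "p = 0")
  case False
  then have "1 \<le> sqrt R * sqrt p" using R by (simp flip: real_sqrt_mult)
  then have "sqrt p * 1 \<le> sqrt p * (sqrt R * sqrt p)" using p by (intro mult_left_mono) auto
  then have sp: "sqrt p \<le> sqrt R * p" using p by (simp add: mult_ac)
  have "sqrt p * (c * v) \<le> (sqrt R * p) * (c * x)"
  proof (rule order_trans)
    show "sqrt p * (c * v) \<le> sqrt p * (c * x)" using v c p by (intro mult_left_mono) auto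
    show "sqrt p * (c * x) \<le> (sqrt R * p) * (c * x)" using sp v c by (intro mult_right_mono) auto
  qed
  then show ?thesis by (simp add: q algebra_simps)
qed (simp add: q)

text \<open>Some \<open>\<phi>' j\<close> is not orthogonal to \<open>\<phi> i\<close>, and symmetry
  of \<open>transpose A ** A\<close> forces the eigenvalues of the two to agree. The purpose is to
  confine all squared singular values to one finite set.\<close>

lemma singular_values_unique:
  fixes A :: "real^'a^'b"
  assumes A: "right_singular_system A \<sigma> \<phi>" and A': "right_singular_system A \<sigma>' \<phi>'" and i: "i \<in> {1..CARD('a)}"
  shows "\<exists>j\<in>{1..CARD('a)}. (\<sigma> i)\<^sup>2 = (\<sigma>' j)\<^sup>2"
proof -
  let ?I = "{1..CARD('a)}"
  have inner: "(A *v \<phi> i) \<bullet> (A *v v) = (\<sigma> i)\<^sup>2 * (\<phi> i \<bullet> v)"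
    if A: "right_singular_system A \<sigma> \<phi>" and i: "i \<in> ?I" for \<sigma> \<phi> i v
  proof -
    have "(A *v \<phi> i) \<bullet> (A *v v) = (\<Sum>j\<in>?I. if i = j then (\<sigma> j)\<^sup>2 * (v \<bullet> \<phi> j) else 0)"
      unfolding right_singular_system_inner[OF A] using A i
      by (intro sum.cong refl) (simp add: right_singular_system_def)
    then show ?thesis using i by (simp add: inner_commute)
  qed
  have "(\<Sum>j\<in>?I. (\<phi> i \<bullet> \<phi>' j) * (\<phi> i \<bullet> \<phi>' j)) \<noteq> 0"
    using orthonormal_parseval[OF right_singular_system_orthonormal[OF A'], of "\<phi> i" "\<phi> i"]
      right_singular_system_norm(2)[OF A i] by (simp add: norm_eq_1)
  then obtain j where j: "j \<in> ?I" "\<phi> i \<bullet> \<phi>' j \<noteq> 0" by (metis (no_types, lifting) mult_zero_left sum.neutral)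
  have "(\<sigma> i)\<^sup>2 * (\<phi> i \<bullet> \<phi>' j) = (\<sigma>' j)\<^sup>2 * (\<phi> i \<bullet> \<phi>' j)"
    using inner[OF A i, of "\<phi>' j"] inner[OF A' j(1), of "\<phi> i"] by (simp add: inner_commute)
  then show ?thesis using j by auto
qed

text \<open>Squared singular values of any system are those of one reference system, so their
  positive differences lie in a finite set, whose minimum serves every \<open>k\<close>. The element
  1 keeps that set nonempty.\<close>

lemma uniform_singular_gap:
  fixes A :: "real^'a^'b"
  shows "\<exists>g>0. \<forall>\<sigma> \<phi> k. right_singular_system A \<sigma> \<phi> \<longrightarrow> 1 \<le> k \<longrightarrow> k < CARD('a) \<longrightarrow> \<sigma> (k + 1) < \<sigma> k \<longrightarrow>
    g \<le> (\<sigma> k)\<^sup>2 - (\<sigma> (k + 1))\<^sup>2"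
proof (cases "\<exists>\<sigma> \<phi>. right_singular_system A \<sigma> \<phi>")
  case True
  then obtain \<sigma>0 \<phi>0 where A0: "right_singular_system A \<sigma>0 \<phi>0" by blast
  let ?I = "{1..CARD('a)}"
  define G where "G = insert 1 {a \<in> (\<lambda>(i, j). (\<sigma>0 i)\<^sup>2 - (\<sigma>0 j)\<^sup>2) ` (?I \<times> ?I). a > 0}"
  have G: "finite G" "G \<noteq> {}" "\<And>a. a \<in> G \<Longrightarrow> a > 0" by (auto simp: G_def)
  show ?thesis
  proof (intro exI[of _ "Min G"] conjI allI impI)
    show "Min G > 0" using G by simp
    fix \<sigma> \<phi> k
    assume A: "right_singular_system A \<sigma> \<phi>" and k: "1 \<le> k" "k < CARD('a)" and lt: "\<sigma> (k + 1) < \<sigma> k"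
    obtain i where i: "i \<in> ?I" "(\<sigma> k)\<^sup>2 = (\<sigma>0 i)\<^sup>2" using singular_values_unique[OF A A0, of k] k by auto
    obtain j where j: "j \<in> ?I" "(\<sigma> (k + 1))\<^sup>2 = (\<sigma>0 j)\<^sup>2" using singular_values_unique[OF A A0, of "k + 1"] k by auto
    have "\<sigma> (k + 1) \<ge> 0" using A k by (simp add: right_singular_system_def)
    then have "(\<sigma> (k + 1))\<^sup>2 < (\<sigma> k)\<^sup>2" using lt by (intro power_strict_mono) auto
    then have "(\<sigma> k)\<^sup>2 - (\<sigma> (k + 1))\<^sup>2 \<in> G" using i j by (auto simp: G_def)
    then show "Min G \<le> (\<sigma> k)\<^sup>2 - (\<sigma> (k + 1))\<^sup>2" using G by simp
  qed
qed (auto intro: exI[of _ 1])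

text \<open>Far from the population the entropy is at least \<open>\<eta>\<^sup>2 / (2 * R)\<close>,
  whatever the estimator does; \<open>\<epsilon>\<^sub>0\<close> is the value at which the claimed
  cost, with \<open>alpha_bar\<close> lowered to \<open>a\<close>, reaches that level. Near the
  population the expansion of the loss applies and density ratios are at most 8 / 7.\<close>

lemma relative_entropy_of_gap:
  fixes P :: "('x::finite \<times> 'y::finite) pmf"
  assumes PX: "\<And>x. PX P x > 0" and PY: "\<And>y. PY P y > 0" and r: "r > 0" and g: "g > 0" and a: "a > 0"
  shows "\<exists>\<epsilon>\<^sub>0>0. \<forall>k \<sigma> \<phi> \<Phi> \<epsilon> s u. 1 \<le> k \<longrightarrow> k < CARD('x) \<longrightarrow> right_singular_system (B_tilde P) \<sigma> \<phi> \<longrightarrow>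
    g \<le> (\<sigma> k)\<^sup>2 - (\<sigma> (k + 1))\<^sup>2 \<longrightarrow> a \<le> alpha_bar P \<sigma> \<phi> k r \<longrightarrow> Phi_bar_estimator r k \<Phi> \<longrightarrow>
    0 < \<epsilon> \<longrightarrow> \<epsilon> < \<epsilon>\<^sub>0 \<longrightarrow> set s \<subseteq> set_pmf P \<longrightarrow> s \<noteq> [] \<longrightarrow> u \<noteq> [] \<longrightarrow>
    \<epsilon> < (frobenius_norm_mult (B_tilde P) k \<phi>)\<^sup>2 - (frobenius_norm_mult (B_tilde P) k (\<Phi> s u))\<^sup>2 \<longrightarrow>
    3 * \<epsilon> / (8 * alpha_bar P \<sigma> \<phi> k r) \<le> kl (empirical s) (pmf P) + r * kl (empirical u) (pmf (map_pmf fst P))"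
proof -
  define R where "R = Max (insert 1 (range (\<lambda>z. 1 / pmf P z) \<union> range (\<lambda>x. 1 / PX P x)))"
  have R1: "R \<ge> 1" unfolding R_def by (intro Max_ge) auto
  have RP: "1 \<le> R * pmf P z" if "pmf P z \<noteq> 0" for z
  proof -
    have "1 / pmf P z \<le> R" unfolding R_def by (intro Max_ge) auto
    then show ?thesis using that by (simp add: divide_le_eq pmf_nonneg order_less_le)
  qed
  have RX: "1 \<le> R * PX P x" for x
  proof -
    have "1 / PX P x \<le> R" unfolding R_def by (intro Max_ge) auto
    then show ?thesis using PX[of x] by (simp add: divide_le_eq)
  qed
  obtain \<eta>1 where \<eta>1: "\<eta>1 > 0" and near: "\<And>w k \<sigma> \<phi> \<tau> \<psi>. norm w < \<eta>1 \<Longrightarrow> 1 \<le> k \<Longrightarrow> k < CARD('x) \<Longrightarrow>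
    right_singular_system (B_tilde P) \<sigma> \<phi> \<Longrightarrow> g \<le> (\<sigma> k)\<^sup>2 - (\<sigma> (k + 1))\<^sup>2 \<Longrightarrow>
    right_singular_system (B_bar_at P r w) \<tau> \<psi> \<Longrightarrow>
    (frobenius_norm_mult (B_tilde P) k \<phi>)\<^sup>2 - (frobenius_norm_mult (B_tilde P) k \<psi>)\<^sup>2
      \<le> (alpha_bar P \<sigma> \<phi> k r + a / 7) * (norm w)\<^sup>2"
    using gap_near_population[OF PX PY r g, of "a / 7"] a by auto
  obtain \<eta>2 where \<eta>2: "\<eta>2 > 0" and nonvanishing: "\<And>w. norm w < \<eta>2 \<Longrightarrow>
    (\<forall>x. PX_hat_at P w x \<noteq> 0) \<and> (\<forall>x. PX_bar_at P r w x \<noteq> 0) \<and> (\<forall>y. PY_bar_at P r w y \<noteq> 0)"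
    using nonvanishing_near_zero[OF PX PY r] by blast
  define c where "c = 1 + 1 / sqrt r"
  have c: "c \<ge> 1" "c \<ge> 1 / sqrt r" using r by (auto simp: c_def)
  define \<eta> where "\<eta> = min (min \<eta>1 \<eta>2) (1 / (7 * (sqrt R * c)))"
  have Rc: "sqrt R * c > 0" using R1 c by simp
  have \<eta>: "\<eta> > 0" using \<eta>1 \<eta>2 Rc by (simp add: \<eta>_def)
  define \<epsilon>\<^sub>0 where "\<epsilon>\<^sub>0 = 4 * a * \<eta>\<^sup>2 / (3 * R)"
  show ?thesis
  proof (intro exI[of _ \<epsilon>\<^sub>0] conjI allI impI)
    show "\<epsilon>\<^sub>0 > 0" using a \<eta> R1 by (simp add: \<epsilon>\<^sub>0_def)
    fix k \<sigma> \<phi> \<Phi> \<epsilon> s u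
    assume k: "1 \<le> k" "k < CARD('x)" and sys: "right_singular_system (B_tilde P) \<sigma> \<phi>"
      and gap: "g \<le> (\<sigma> k)\<^sup>2 - (\<sigma> (k + 1))\<^sup>2" and \<alpha>: "a \<le> alpha_bar P \<sigma> \<phi> k r"
      and \<Phi>: "Phi_bar_estimator r k \<Phi>" and \<epsilon>: "0 < \<epsilon>" "\<epsilon> < \<epsilon>\<^sub>0"
      and s: "set s \<subseteq> set_pmf P" "s \<noteq> []" and u: "u \<noteq> []"
      and large: "\<epsilon> < (frobenius_norm_mult (B_tilde P) k \<phi>)\<^sup>2 - (frobenius_norm_mult (B_tilde P) k (\<Phi> s u))\<^sup>2"
    define \<alpha> where "\<alpha> = alpha_bar P \<sigma> \<phi> k r"
    define w where "w = deviation P r s u"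
    define D where "D = kl (empirical s) (pmf P) + r * kl (empirical u) (pmf (map_pmf fst P))"
    have \<alpha>_pos: "\<alpha> > 0" "a \<le> \<alpha>" using \<alpha> a by (auto simp: \<alpha>_def)
    note at = estimates_at_deviation[OF s(1) PX r, of u, folded w_def]
    have "3 * \<epsilon> / (8 * \<alpha>) \<le> D"
    proof (cases "norm w < \<eta>")
      case False
      have "(norm w)\<^sup>2 \<le> 2 * R * D"
        unfolding w_def D_def
      proof (rule norm_deviation_le_kl[OF s(2) u r R1])
        show "empirical s z \<le> R * pmf P z" for z
        proof (cases "z \<in> set s")
          case True
          then have "pmf P z \<noteq> 0" using s by (auto simp: set_pmf_iff)
          then show ?thesis using RP[of z] empirical_le_1[of s z] by linarith
        qed (use R1 in \<open>simp add: empirical_outside\<close>)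
        show "empirical u x \<le> R * PX P x" for x
          using RX[of x] empirical_le_1[of u x] by linarith
      qed
      moreover have "\<eta>\<^sup>2 \<le> (norm w)\<^sup>2" using False \<eta> by (intro power_mono) auto
      ultimately have "\<eta>\<^sup>2 / (2 * R) \<le> D" using R1 by (simp add: divide_le_eq mult_ac)
      moreover have "3 * \<epsilon> / (8 * \<alpha>) \<le> 3 * \<epsilon>\<^sub>0 / (8 * a)"
        using \<epsilon> \<alpha>_pos a by (intro frac_le) auto
      moreover have "3 * \<epsilon>\<^sub>0 / (8 * a) = \<eta>\<^sup>2 / (2 * R)"
        using a R1 by (simp add: \<epsilon>\<^sub>0_def field_simps)
      ultimately show ?thesis by linarith
    next
      case True
      have w_small: "norm w < \<eta>1" "norm w < \<eta>2" "sqrt R * c * norm w \<le> 1 / 7"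
        using True Rc by (auto simp: \<eta>_def field_simps)
      have "nonvanishing_denominators r s u"
        using nonvanishing[OF w_small(2)] by (simp add: nonvanishing_denominators_def at)
      then obtain \<tau> \<psi> where sys': "right_singular_system (B_bar_at P r w) \<tau> \<psi>"
        and \<psi>: "\<And>i. i \<in> {1..k} \<Longrightarrow> \<Phi> s u i = \<psi> i"
        using \<Phi> unfolding Phi_bar_estimator_def top_right_singular_vectors_def at by metis
      have "frobenius_norm_mult (B_tilde P) k (\<Phi> s u) = frobenius_norm_mult (B_tilde P) k \<psi>"
        unfolding frobenius_norm_mult_def by (simp add: \<psi>)
      then have "\<epsilon> < (\<alpha> + a / 7) * (norm w)\<^sup>2"
        using near[OF w_small(1) k sys gap sys'] large by (simp add: \<alpha>_def)
      also have "\<dots> \<le> (8 / 7 * \<alpha>) * (norm w)\<^sup>2"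
        using \<alpha>_pos by (intro mult_right_mono) auto
      also have "(norm w)\<^sup>2 \<le> 2 * (8 / 7) * D"
        unfolding w_def D_def
      proof (rule norm_deviation_le_kl[OF s(2) u r])
        have comp: "\<bar>w $ i\<bar> \<le> norm w" for i by (rule component_le_norm_cart)
        have le: "1 + sqrt R * b * norm w \<le> 8 / 7" if "b \<le> c" for b
        proof -
          have "sqrt R * b * norm w \<le> sqrt R * c * norm w"
            using that R1 by (intro mult_right_mono mult_left_mono) auto
          then show ?thesis using w_small(3) by linarith
        qed
        show "empirical s z \<le> 8 / 7 * pmf P z" for z
        proof -
          have "empirical s z \<le> (1 + sqrt R * 1 * norm w) * pmf P z"
            using fun_cong[OF fun_cong[OF at(1)], of "fst z" "snd z"]
            by (intro ratio_le_of_deviation[OF _ comp[of "Inl z"] _ RP]) (simp_all add: PXY_at_def)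
          also have "\<dots> \<le> 8 / 7 * pmf P z" by (intro mult_right_mono le c) simp
          finally show ?thesis .
        qed
        show "empirical u x \<le> 8 / 7 * PX P x" for x
        proof -
          have "empirical u x \<le> (1 + sqrt R * (1 / sqrt r) * norm w) * PX P x"
            using fun_cong[OF at(3), of x] r
            by (intro ratio_le_of_deviation[OF _ comp[of "Inr x"] _ RX PX_nonneg]) (simp_all add: QX_at_def)
          also have "\<dots> \<le> 8 / 7 * PX P x" by (intro mult_right_mono le c PX_nonneg)
          finally show ?thesis .
        qed
      qed simp
      finally have "\<epsilon> < 8 / 7 * \<alpha> * (2 * (8 / 7) * D)" using \<alpha>_pos by simp
      \<comment> \<open>A factor 8 / 7 from the loss and one from the density ratio turn the ideal 1
        / 2 into 49 / 128, which just exceeds 48 / 128 = 3 / 8. Hence the tolerances of 1 /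
        7.\<close>
      then have "\<epsilon> * 49 < 128 * (\<alpha> * D)" by simp
      moreover have "48 * \<epsilon> \<le> \<epsilon> * 49" using \<epsilon> by simp
      ultimately have "3 * \<epsilon> \<le> D * (8 * \<alpha>)" by (simp add: mult_ac)
      then show ?thesis using \<alpha>_pos by (simp add: divide_le_eq)
    qed
    then show "3 * \<epsilon> / (8 * alpha_bar P \<sigma> \<phi> k r)
        \<le> kl (empirical s) (pmf P) + r * kl (empirical u) (pmf (map_pmf fst P))"
      by (simp add: \<alpha>_def D_def)
  qed
qed

theorem theorem5:
  fixes P :: "('x::finite \<times> 'y::finite) pmf" and r :: real
  assumes "\<And>x. PX P x > 0" and "\<And>y. PY P y > 0"
    and "r > 0"
  shows "\<exists>\<epsilon>\<^sub>0>0. \<forall>(k::nat) (\<sigma>::nat \<Rightarrow> real) (\<phi>::nat \<Rightarrow> real^'x).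
    1 \<le> k \<longrightarrow> k < CARD('x) \<longrightarrow> right_singular_system (B_tilde P) \<sigma> \<phi> \<longrightarrow> \<sigma> k > \<sigma> (k + 1) \<longrightarrow>
    (\<forall>(\<Phi>::('x \<times> 'y) list \<Rightarrow> 'x list \<Rightarrow> nat \<Rightarrow> real^'x) (\<epsilon>::real) (\<delta>::real) (n::nat) (m::nat).
       Phi_bar_estimator r k \<Phi> \<longrightarrow>
       0 < \<epsilon> \<longrightarrow> \<epsilon> < \<epsilon>\<^sub>0 \<longrightarrow> 0 < \<delta> \<longrightarrow> \<delta> < 1 \<longrightarrow>
       real m = real n * r \<longrightarrow>
       real n > N_bar CARD('x) CARD('y) (4 * alpha_bar P \<sigma> \<phi> k r) \<epsilon> \<delta> r \<longrightarrow>
       measure_pmf.prob (sample_law P n m)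
         {(s, u). (frobenius_norm_mult (B_tilde P) k \<phi>)\<^sup>2
                  - (frobenius_norm_mult (B_tilde P) k (\<Phi> s u))\<^sup>2 > \<epsilon>} < \<delta>)"
proof -
  note r = assms(3)
  obtain g where g: "g > 0" and gap: "\<And>\<sigma> \<phi> k. right_singular_system (B_tilde P) \<sigma> \<phi> \<Longrightarrow> 1 \<le> k \<Longrightarrow>
      k < CARD('x) \<Longrightarrow> \<sigma> (k + 1) < \<sigma> k \<Longrightarrow> g \<le> (\<sigma> k)\<^sup>2 - (\<sigma> (k + 1))\<^sup>2"
    using uniform_singular_gap[of "B_tilde P"] by blast
  \<comment> \<open>The bound of \<open>alpha_bar_lower\<close>, with the square of the largest
    singular value lowered to \<open>g\<close>.\<close>
  define a where "a = r / (4 * (1 + r)\<^sup>2) * g"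
  have a: "a > 0" using r g by (simp add: a_def)
  obtain \<epsilon>1 where \<epsilon>1: "\<epsilon>1 > 0" and entropy: "\<And>k \<sigma> \<phi> \<Phi> \<epsilon> s u. 1 \<le> k \<Longrightarrow> k < CARD('x) \<Longrightarrow>
    right_singular_system (B_tilde P) \<sigma> \<phi> \<Longrightarrow>
    g \<le> (\<sigma> k)\<^sup>2 - (\<sigma> (k + 1))\<^sup>2 \<Longrightarrow> a \<le> alpha_bar P \<sigma> \<phi> k r \<Longrightarrow> Phi_bar_estimator r k \<Phi> \<Longrightarrow>
    0 < \<epsilon> \<Longrightarrow> \<epsilon> < \<epsilon>1 \<Longrightarrow> set s \<subseteq> set_pmf P \<Longrightarrow> s \<noteq> [] \<Longrightarrow> u \<noteq> [] \<Longrightarrow>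
    \<epsilon> < (frobenius_norm_mult (B_tilde P) k \<phi>)\<^sup>2 - (frobenius_norm_mult (B_tilde P) k (\<Phi> s u))\<^sup>2 \<Longrightarrow>
    3 * \<epsilon> / (8 * alpha_bar P \<sigma> \<phi> k r) \<le> kl (empirical s) (pmf P) + r * kl (empirical u) (pmf (map_pmf fst P))"
    using relative_entropy_of_gap[OF assms g a] by blast
  show ?thesis
  \<comment> \<open>The bound \<open>\<epsilon> < a\<close> makes the argument of the logarithm in
    \<open>N_bar\<close> at least 1. So \<open>N_bar\<close> is nonnegative and \<open>n\<close> and
    \<open>m\<close> are positive, which excludes empty samples.\<close>
  proof (intro exI[of _ "min a \<epsilon>1"] conjI allI impI)
    show "min a \<epsilon>1 > 0" using a \<epsilon>1 by simp
    fix k :: nat and \<sigma> :: "nat \<Rightarrow> real" and \<phi> :: "nat \<Rightarrow> real^'x"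
      and \<Phi> :: "('x \<times> 'y) list \<Rightarrow> 'x list \<Rightarrow> nat \<Rightarrow> real^'x" and \<epsilon> \<delta> :: real and n m :: nat
    assume k: "1 \<le> k" "k < CARD('x)" and sys: "right_singular_system (B_tilde P) \<sigma> \<phi>"
      and lt: "\<sigma> (k + 1) < \<sigma> k" and \<Phi>: "Phi_bar_estimator r k \<Phi>"
      and \<epsilon>: "0 < \<epsilon>" "\<epsilon> < min a \<epsilon>1" and \<delta>: "0 < \<delta>" "\<delta> < 1" and m: "real m = real n * r"
      and N: "N_bar CARD('x) CARD('y) (4 * alpha_bar P \<sigma> \<phi> k r) \<epsilon> \<delta> r < real n"
    define t where "t = 4 * alpha_bar P \<sigma> \<phi> k r"
    have "\<sigma> k \<le> \<sigma> 1" "\<sigma> k \<ge> 0" using sys k by (auto simp: right_singular_system_def)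
    then have "(\<sigma> k)\<^sup>2 \<le> (\<sigma> 1)\<^sup>2" by (intro power_mono)
    then have "g \<le> (\<sigma> 1)\<^sup>2" using gap[OF sys k lt] by (smt (verit) zero_le_power2)
    then have "a \<le> r / (4 * (1 + r)\<^sup>2) * (\<sigma> 1)\<^sup>2" unfolding a_def using r by (intro mult_left_mono) auto
    also have "\<dots> \<le> alpha_bar P \<sigma> \<phi> k r" by (rule alpha_bar_lower[OF assms sys k lt])
    finally have \<alpha>: "a \<le> alpha_bar P \<sigma> \<phi> k r" .
    then have t: "t > 0" "\<epsilon> \<le> t" using a \<epsilon> by (auto simp: t_def)
    have card: "real CARD('x) \<ge> 1" "real CARD('y) \<ge> 1" by (simp_all add: Suc_leI)
    have "\<epsilon> * 1 * 1 * 1 \<le> (9 * t) * (1 + r) * real CARD('x) * real CARD('y)"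
      using t \<epsilon> r card by (intro mult_mono) auto
    then have "0 \<le> ln (9 * t * (1 + r) * real CARD('x) * real CARD('y) / \<epsilon>)"
      using \<epsilon> by (intro ln_ge_zero) (simp add: le_divide_eq)
    moreover have "0 \<le> ln (1 / \<delta>)" using \<delta> by (intro ln_ge_zero) simp
    ultimately have "0 \<le> N_bar CARD('x) CARD('y) t \<epsilon> \<delta> r"
      unfolding N_bar_def using t(1) \<epsilon>(1)
      by (intro add_nonneg_nonneg mult_nonneg_nonneg divide_nonneg_nonneg) auto
    then have n: "n > 0" using N by (simp add: t_def)
    then have "real m > 0" using m r by simp
    then have m0: "m > 0" by simp
    let ?A = "{(s, u). (frobenius_norm_mult (B_tilde P) k \<phi>)\<^sup>2 - (frobenius_norm_mult (B_tilde P) k (\<Phi> s u))\<^sup>2 > \<epsilon>}"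
    have "measure_pmf.prob (sample_law P n m) ?A
        \<le> real (n + 1) ^ CARD('x \<times> 'y) * real (m + 1) ^ CARD('x) * exp (- (real n * (3 * \<epsilon> / (2 * t))))"
      unfolding sample_law_def
    proof (rule method_of_types[OF n m0])
      fix s u
      assume su: "(s, u) \<in> ?A" "length s = n" "set s \<subseteq> set_pmf P" "length u = m"
      then have "s \<noteq> []" "u \<noteq> []" using n m0 by auto
      with su have "3 * \<epsilon> / (2 * t) \<le> kl (empirical s) (pmf P) + r * kl (empirical u) (pmf (map_pmf fst P))"
        using entropy[OF k sys gap[OF sys k lt] \<alpha> \<Phi> \<epsilon>(1), of s u] \<epsilon>(2) by (simp add: t_def)
      then have "real n * (3 * \<epsilon> / (2 * t))
          \<le> real n * (kl (empirical s) (pmf P) + r * kl (empirical u) (pmf (map_pmf fst P)))"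
        by (intro mult_left_mono) auto
      then show "real n * (3 * \<epsilon> / (2 * t))
          \<le> real n * kl (empirical s) (pmf P) + real m * kl (empirical u) (pmf (map_pmf fst P))"
        by (simp add: m algebra_simps)
    qed
    also have "\<dots> < \<delta>"
      using sample_size_bound[OF _ _ _ t(1) r \<epsilon>(1) \<delta>(1) m, of "CARD('x)" "CARD('y)"] N n
      by (simp add: t_def Suc_leI)
    finally show "measure_pmf.prob (sample_law P n m) ?A < \<delta>" .
  qed
qed

end
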